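(* For every constant $w$, Plan Verification is solvable in polynomial time on instances whose initial task network $(T,\prec^+,\alpha)$ is primitive and has generalized partial order width at most $w$.
   Context: An HTN domain is a tuple $D=(F,A,\mathcal{C},\delta,M)$ where $F$ is a finite set of propositions, $A$ a set of actions, $\mathcal{C}$ a set of compound task names disjoint from $A$, $\delta$ maps each action $a$ to $(\mathrm{pre}(a),\mathrm{del}(a),\mathrm{add}(a))$, subsets of $F$, and $M$ gives decomposition methods. Action $a$ is executable in state $s\subseteq F$ if $\mathrm{pre}(a)\subseteq s$; executing it yields $(s\setminus\mathrm{del}(a))\cup\mathrm{add}(a)$; a plan (action sequence) is executable in $s$ if its actions can be executed consecutively from $s$. A task network is $(T,\prec^+,\alpha)$ with $T$ finite, $\prec^+$ a strict partial order on $T$, $\alpha:T\to A\cup\mathcal{C}$; primitive if $\alpha(T)\subseteq A$. A linearization is a total order $\bar t$ of $T$ extending $\prec^+$, with action sequence $\alpha(\bar t)$. Plan Verification (for a primitive network $tn$): given $tn$, an initial state $s_0\subseteq F$ and a plan $p$ over $A$, decide whether $tn$ has a linearization $\bar t$ with $\alpha(\bar t)=p$ and $p$ executable in $s_0$. The partial order width of a partial order is the size of its largest antichain. An element is isolated if it is incomparable to every other element. The generalized partial order width of $\prec^+$ is the partial order width of $\prec^+$ restricted to the non-isolated elements. *)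

theory Defs
  imports Main
begin

text \<open>Propositions, action names and task identifiers are natural numbers.
  An instance consists of the action table (name, pre, del, add), the task
  set T, the strict partial order (given as a list of pairs), the labelling
  alpha : T -> A (primitive network: every task is labelled by an action),
  the initial state s0 and the plan p.\<close>

datatype pv_inst = PVInst
  (acts: "(nat \<times> nat list \<times> nat list \<times> nat list) list")
  (tasks: "nat list")
  (ord: "(nat \<times> nat) list")
  (lab: "(nat \<times> nat) list")
  (init: "nat list")
  (plan: "nat list")

definition act_names :: "pv_inst \<Rightarrow> nat set" where
  "act_names I = set (map fst (acts I))"

definition pre_of :: "pv_inst \<Rightarrow> nat \<Rightarrow> nat set" where
  "pre_of I a = (case map_of (acts I) a of Some (p, d, e) \<Rightarrow> set p | None \<Rightarrow> {})"

definition del_of :: "pv_inst \<Rightarrow> nat \<Rightarrow> nat set" where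
  "del_of I a = (case map_of (acts I) a of Some (p, d, e) \<Rightarrow> set d | None \<Rightarrow> {})"

definition add_of :: "pv_inst \<Rightarrow> nat \<Rightarrow> nat set" where
  "add_of I a = (case map_of (acts I) a of Some (p, d, e) \<Rightarrow> set e | None \<Rightarrow> {})"

definition alpha :: "pv_inst \<Rightarrow> nat \<Rightarrow> nat" where
  "alpha I t = the (map_of (lab I) t)"

definition prec :: "pv_inst \<Rightarrow> (nat \<times> nat) set" where
  "prec I = set (ord I)"

definition strict_po_on :: "'a set \<Rightarrow> ('a \<times> 'a) set \<Rightarrow> bool" where
  "strict_po_on S R \<longleftrightarrow> R \<subseteq> S \<times> S \<and> irrefl R \<and> trans R"

definition valid_inst :: "pv_inst \<Rightarrow> bool" where
  "valid_inst I \<longleftrightarrow>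
     distinct (map fst (acts I)) \<and>
     distinct (tasks I) \<and>
     strict_po_on (set (tasks I)) (prec I) \<and>
     distinct (map fst (lab I)) \<and> set (map fst (lab I)) = set (tasks I) \<and>
     (\<forall>(t, a) \<in> set (lab I). a \<in> act_names I) \<and>
     set (plan I) \<subseteq> act_names I"

fun executable :: "pv_inst \<Rightarrow> nat set \<Rightarrow> nat list \<Rightarrow> bool" where
  "executable I s [] = True"
| "executable I s (a # p) =
     (pre_of I a \<subseteq> s \<and> executable I ((s - del_of I a) \<union> add_of I a) p)"

definition is_linearization :: "'a set \<Rightarrow> ('a \<times> 'a) set \<Rightarrow> 'a list \<Rightarrow> bool" where
  "is_linearization T R ts \<longleftrightarrow> distinct ts \<and> set ts = T \<and>
     (\<forall>i j. i < j \<and> j < length ts \<longrightarrow> (ts ! j, ts ! i) \<notin> R)"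

definition plan_verification :: "pv_inst \<Rightarrow> bool" where
  "plan_verification I \<longleftrightarrow>
     (\<exists>ts. is_linearization (set (tasks I)) (prec I) ts \<and>
           map (alpha I) ts = plan I \<and>
           executable I (set (init I)) (plan I))"

definition antichain_of :: "('a \<times> 'a) set \<Rightarrow> 'a set \<Rightarrow> bool" where
  "antichain_of R A \<longleftrightarrow> (\<forall>x\<in>A. \<forall>y\<in>A. x \<noteq> y \<longrightarrow> (x, y) \<notin> R \<and> (y, x) \<notin> R)"

definition po_width :: "'a set \<Rightarrow> ('a \<times> 'a) set \<Rightarrow> nat" where
  "po_width S R = Max (card ` {A. A \<subseteq> S \<and> antichain_of R A})"

definition isolated :: "'a set \<Rightarrow> ('a \<times> 'a) set \<Rightarrow> 'a \<Rightarrow> bool" where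
  "isolated S R x \<longleftrightarrow> (\<forall>y\<in>S. y \<noteq> x \<longrightarrow> (x, y) \<notin> R \<and> (y, x) \<notin> R)"

definition gen_po_width :: "'a set \<Rightarrow> ('a \<times> 'a) set \<Rightarrow> nat" where
  "gen_po_width S R =
     (let S' = {x \<in> S. \<not> isolated S R x} in po_width S' (R \<inter> (S' \<times> S')))"

text \<open>Tape symbols: 0 = blank, 1 = bit 0, 2 = bit 1, 3 = open bracket,
  4 = close bracket.\<close>

fun bits :: "nat \<Rightarrow> nat list" where
  "bits n = (if n = 0 then [] else (n mod 2 + 1) # bits (n div 2))"

definition enc_nat :: "nat \<Rightarrow> nat list" where
  "enc_nat n = 3 # bits n @ [4]"

definition enc_list :: "('a \<Rightarrow> nat list) \<Rightarrow> 'a list \<Rightarrow> nat list" where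
  "enc_list f xs = 3 # concat (map f xs) @ [4]"

definition enc_pair :: "('a \<Rightarrow> nat list) \<Rightarrow> ('b \<Rightarrow> nat list) \<Rightarrow> 'a \<times> 'b \<Rightarrow> nat list" where
  "enc_pair f g x = 3 # f (fst x) @ g (snd x) @ [4]"

definition enc_inst :: "pv_inst \<Rightarrow> nat list" where
  "enc_inst I = 3 #
      enc_list (enc_pair enc_nat (enc_pair (enc_list enc_nat)
                 (enc_pair (enc_list enc_nat) (enc_list enc_nat)))) (acts I)
    @ enc_list enc_nat (tasks I)
    @ enc_list (enc_pair enc_nat enc_nat) (ord I)
    @ enc_list (enc_pair enc_nat enc_nat) (lab I)
    @ enc_list enc_nat (init I)
    @ enc_list enc_nat (plan I) @ [4]"

text \<open>A machine is (number of states Q, number of tape symbols S, transition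
  function). States are 0..Q-1 with start state 0, accepting halt state 1 and
  rejecting halt state 2; tape symbols are 0..S-1 with blank 0. Head moves are
  -1, 0, 1. Only the finitely many values of delta on states < Q and symbols < S
  matter.\<close>

type_synonym tm = "nat \<times> nat \<times> (nat \<Rightarrow> nat \<Rightarrow> nat \<times> nat \<times> int)"
type_synonym tm_config = "nat \<times> (int \<Rightarrow> nat) \<times> int"

definition tm_wf :: "tm \<Rightarrow> bool" where
  "tm_wf M = (case M of (Q, S, \<delta>) \<Rightarrow>
     3 \<le> Q \<and> 5 \<le> S \<and>
     (\<forall>q<Q. \<forall>s<S. case \<delta> q s of (q', s', m) \<Rightarrow>
         q' < Q \<and> s' < S \<and> m \<in> {-1, 0, 1}))"

definition tm_step :: "tm \<Rightarrow> tm_config \<Rightarrow> tm_config" where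
  "tm_step M c = (case M of (Q, S, \<delta>) \<Rightarrow> case c of (q, tp, h) \<Rightarrow>
     if q = 1 \<or> q = 2 then (q, tp, h)
     else (case \<delta> q (tp h) of (q', s', m) \<Rightarrow> (q', tp(h := s'), h + m)))"

definition tm_init :: "nat list \<Rightarrow> tm_config" where
  "tm_init x = (0, \<lambda>i. if 0 \<le> i \<and> i < int (length x) then x ! nat i else 0, 0)"

definition tm_state_after :: "tm \<Rightarrow> nat list \<Rightarrow> nat \<Rightarrow> nat" where
  "tm_state_after M x n = fst ((tm_step M ^^ n) (tm_init x))"

end

theory Submission
  imports Defs "HOL-Library.Sublist" "HOL-Library.Multiset"
begin

text \<open>Isolated tasks can be placed anywhere, so a plan is realized by the network iff the labels
  of all tasks form the same multiset as the plan and some linearization of the non-isolated tasks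
  is labelled by a subsequence of the plan. Reading the plan from left to right, one maintains the
  set of possible sets of non-isolated tasks that are still to be executed. These are up-sets of an
  order of width at most \<open>w\<close>, hence determined by an antichain of at most \<open>w\<close> minimal elements, so
  that there are only polynomially many of them; no knowledge of \<open>w\<close> is needed to compute them.

  That this runs on a Turing machine in polynomial time is shown through programs on four stacks:
  the machine keeps the stacks on parallel tracks, and data are trees in prefix code. A function is
  polynomial-time if such a program replaces the code of the argument on top of the main
  stack by the code of the result, whatever lies below; this makes the notion closed under
  composition, pairing, case distinction and bounded iteration.\<close>

text \<open>The delicate point is size, not the number of rounds: iterating a polynomial-time
  function polynomially often can still build exponentially large data, so the loop rules rest on a
  polynomial bound for all intermediate values. For the possible sets of remaining tasks this bound
  is the count of up-sets, and it applies only if no up-set is stored twice. Hence each set is kept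
  as a sublist of one fixed list, and duplicates are removed after every letter of the plan. The
  bound holds for the promised instances only, which is why being polynomial-time is relative to a
  domain \<open>D\<close>. Executability concerns the plan and the initial state but not the order,
  so it is checked apart from the search. Of the four stacks one holds the data, two serve for
  transfers, and one is a unary counter for reading prefix code.\<close>

datatype sym = Bit bool | Op | Cl

datatype reg = RA | RB | RC | RD

type_synonym stacks = "reg \<Rightarrow> sym list"
type_synonym view = "reg \<Rightarrow> sym option"

datatype com = Skip
  | Push reg "view \<Rightarrow> sym option"
  | Pop reg
  | Seq com com (infixr ";;" 60)
  | Cond "view \<Rightarrow> bool" com com
  | While "view \<Rightarrow> bool" com

definition cell_of :: "stacks \<Rightarrow> nat \<Rightarrow> view" where
  "cell_of s j = (\<lambda>r. if j < length (s r) then Some (s r ! j) else None)"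

abbreviation tops :: "stacks \<Rightarrow> view" where
  "tops s \<equiv> cell_of s 0"

fun push_opt :: "reg \<Rightarrow> sym option \<Rightarrow> stacks \<Rightarrow> stacks" where
  "push_opt r None s = s"
| "push_opt r (Some a) s = s(r := a # s r)"

inductive exec :: "com \<Rightarrow> stacks \<Rightarrow> nat \<Rightarrow> stacks \<Rightarrow> bool" where
  exec_Skip: "exec Skip s 1 s"
| exec_Push: "exec (Push r v) s 1 (push_opt r (v (tops s)) s)"
| exec_Pop: "exec (Pop r) s 1 (s(r := tl (s r)))"
| exec_Seq: "exec p s t s' \<Longrightarrow> exec q s' t' s'' \<Longrightarrow> exec (p ;; q) s (Suc (t + t')) s''"
| exec_CondT: "b (tops s) \<Longrightarrow> exec p s t s' \<Longrightarrow> exec (Cond b p q) s (Suc t) s'"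
| exec_CondF: "\<not> b (tops s) \<Longrightarrow> exec q s t s' \<Longrightarrow> exec (Cond b p q) s (Suc t) s'"
| exec_WhileF: "\<not> b (tops s) \<Longrightarrow> exec (While b p) s 1 s"
| exec_WhileT: "b (tops s) \<Longrightarrow> exec p s t s' \<Longrightarrow> exec (While b p) s' t' s'' \<Longrightarrow>
    exec (While b p) s (Suc (t + t')) s''"

text \<open>A unit of time pushes at most one symbol. Running time therefore bounds the height of
  the stacks, and with it the cost of shifting a track of the tape.\<close>

lemma exec_length: "exec p s t s' \<Longrightarrow> length (s' r) \<le> length (s r) + t"
proof (induction rule: exec.induct)
  case (exec_Push r' v s)
  then show ?case by (cases "v (tops s)") auto
qed auto

section \<open>A Turing machine for stack programs\<close>

text \<open>\<open>Shift\<close> walks right and exchanges the carried symbol for the one it reads;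
  \<open>Return\<close> then brings the head back. A pop starts from the far end, found by
  \<open>Seek\<close>, so that the pass of \<open>Unshift\<close> towards the marker both moves the
  symbols and brings the head home.\<close>

datatype phase = Home | Shift reg sym | Return | Seek reg | Unshift reg "sym option"

datatype state = Start | Mark | Acc | Rej | Run "com list" phase

type_synonym cell = "view option"

type_synonym config = "state \<times> (int \<Rightarrow> cell) \<times> int"

text \<open>The tape carries one track per stack, with the top of every stack at cell 0 and the
  marker \<^term>\<open>None :: cell\<close> at cell -1. Pushing and popping shift a whole track.
  The control state contains the list of commands that remain to be executed.\<close>

fun home_step :: "com list \<Rightarrow> view \<Rightarrow> state" where
  "home_step [] f = (if f RA = Some Cl then Rej else Acc)"
| "home_step (Skip # k) f = Run k Home"
| "home_step (Push r v # k) f =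
     (case v f of None \<Rightarrow> Run k Home | Some a \<Rightarrow> Run k (Shift r a))"
| "home_step (Pop r # k) f = Run k (Seek r)"
| "home_step ((p ;; q) # k) f = Run (p # q # k) Home"
| "home_step (Cond b p q # k) f = Run ((if b f then p else q) # k) Home"
| "home_step (While b p # k) f = Run (if b f then p # While b p # k else k) Home"

fun run_step :: "com list \<Rightarrow> phase \<Rightarrow> cell \<Rightarrow> state \<times> cell \<times> int" where
  "run_step k Home (Some f) = (home_step k f, Some f, 0)"
| "run_step k Home None = (Rej, None, 0)"
| "run_step k (Shift r a) (Some f) = (case f r of
      None \<Rightarrow> (Run k Return, Some (f(r := Some a)), -1)
    | Some b \<Rightarrow> (Run k (Shift r b), Some (f(r := Some a)), 1))"
| "run_step k (Shift r a) None = (Rej, None, 0)"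
| "run_step k Return (Some f) = (Run k Return, Some f, -1)"
| "run_step k Return None = (Run k Home, None, 1)"
| "run_step k (Seek r) (Some f) =
     (if f r = None then (Run k (Unshift r None), Some f, -1) else (Run k (Seek r), Some f, 1))"
| "run_step k (Seek r) None = (Rej, None, 0)"
| "run_step k (Unshift r a) (Some f) = (Run k (Unshift r (f r)), Some (f(r := a)), -1)"
| "run_step k (Unshift r a) None = (Run k Home, None, 1)"

fun trans_fun :: "com \<Rightarrow> state \<Rightarrow> cell \<Rightarrow> state \<times> cell \<times> int" where
  "trans_fun p Start x = (Mark, x, -1)"
| "trans_fun p Mark x = (Run [p] Home, None, 1)"
| "trans_fun p Acc x = (Acc, x, 0)"
| "trans_fun p Rej x = (Rej, x, 0)"
| "trans_fun p (Run k ph) x = run_step k ph x"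

fun mstep :: "com \<Rightarrow> config \<Rightarrow> config" where
  "mstep p (q, tp, h) = (case trans_fun p q (tp h) of (q', x, m) \<Rightarrow> (q', tp(h := x), h + m))"

text \<open>Left of the marker stands the all-empty view, not the marker: it is the image of the
  blank, which the initial tape shows there.\<close>

definition tape :: "stacks \<Rightarrow> int \<Rightarrow> cell" where
  "tape s i = (if i = -1 then None else if i < 0 then Some (\<lambda>_. None)
     else Some (cell_of s (nat i)))"

lemma tape_simps [simp]: "tape s (-1) = None" "tape s (int j) = Some (cell_of s j)"
  "tape s 0 = Some (tops s)"
  by (auto simp: tape_def)

lemma fun_upd_tape_None [simp]: "(tape s)(-1 := None) = tape s"
  by (auto simp: tape_def)

lemma fun_upd_tape_int [simp]: "(tape s)(int j := Some (cell_of s j)) = tape s"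
  "(tape s)(0 := Some (tops s)) = tape s"
  by (auto simp: tape_def)

lemma cell_of_mid [simp]: "cell_of (s(r := ys @ b # zs)) (length ys) r = Some b"
  "cell_of (s(r := ys)) (length ys) r = None"
  by (auto simp: cell_of_def)

lemma tape_write_mid:
  "(tape (s(r := ys @ b # zs)))(int (length ys) :=
      Some ((cell_of (s(r := ys @ b # zs)) (length ys))(r := Some c))) = tape (s(r := ys @ c # zs))"
  by (rule ext) (auto simp: tape_def cell_of_def fun_eq_iff nth_append nth_Cons')

lemma tape_write_end:
  "(tape (s(r := ys)))(int (length ys) :=
      Some ((cell_of (s(r := ys)) (length ys))(r := Some c))) = tape (s(r := ys @ [c]))"
  by (rule ext) (auto simp: tape_def cell_of_def fun_eq_iff nth_append nth_Cons')

lemma tape_erase_end: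
  "(tape (s(r := ys @ [b])))(int (length ys) :=
      Some ((cell_of (s(r := ys @ [b])) (length ys))(r := None))) = tape (s(r := ys))"
  by (rule ext) (auto simp: tape_def cell_of_def fun_eq_iff nth_append nth_Cons')

definition msteps :: "com \<Rightarrow> nat \<Rightarrow> config \<Rightarrow> config \<Rightarrow> bool" where
  "msteps p n c c' \<longleftrightarrow> (mstep p ^^ n) c = c'"

lemma msteps_0 [simp]: "msteps p 0 c c' \<longleftrightarrow> c = c'"
  by (auto simp: msteps_def)

lemma msteps_Suc: "msteps p (Suc n) c c' \<longleftrightarrow> msteps p n (mstep p c) c'"
  by (simp add: msteps_def funpow_swap1)

lemma msteps_trans: "msteps p m c c' \<Longrightarrow> msteps p n c' c'' \<Longrightarrow> msteps p (m + n) c c''"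
  unfolding msteps_def by (subst add.commute) (simp add: funpow_add)

lemma msteps_return:
  "msteps p (j + 1) (Run k Return, tape s, int j - 1) (Run k Home, tape s, 0)"
proof (induction j)
  case 0
  then show ?case by (simp add: msteps_Suc)
next
  case (Suc j)
  then show ?case by (simp add: msteps_Suc algebra_simps)
qed

text \<open>Loop invariant: \<open>ys\<close> is the part of the track already rewritten, and the
  carried symbol \<open>c\<close> belongs between it and the unread part \<open>zs\<close>.\<close>

lemma msteps_shift:
  "msteps p (length zs + 1) (Run k (Shift r c), tape (s(r := ys @ zs)), int (length ys))
     (Run k Return, tape (s(r := ys @ c # zs)), int (length ys + length zs) - 1)"
proof (induction zs arbitrary: ys c)
  case Nil
  then show ?case
    by (simp add: msteps_Suc tape_write_end del: fun_upd_apply)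
next
  case (Cons b zs)
  have "mstep p (Run k (Shift r c), tape (s(r := ys @ b # zs)), int (length ys)) =
    (Run k (Shift r b), tape (s(r := (ys @ [c]) @ zs)), int (length (ys @ [c])))"
    by (simp add: tape_write_mid del: fun_upd_apply)
  then show ?case
    using Cons.IH[of b "ys @ [c]"] by (simp add: msteps_Suc del: fun_upd_apply mstep.simps)
qed

lemma msteps_seek:
  "msteps p (length zs + 1) (Run k (Seek r), tape (s(r := ys @ zs)), int (length ys))
     (Run k (Unshift r None), tape (s(r := ys @ zs)), int (length ys + length zs) - 1)"
proof (induction zs arbitrary: ys)
  case Nil
  then show ?case
    by (simp add: msteps_Suc del: fun_upd_apply)
next
  case (Cons b zs)
  have "mstep p (Run k (Seek r), tape (s(r := ys @ b # zs)), int (length ys)) =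
    (Run k (Seek r), tape (s(r := (ys @ [b]) @ zs)), int (length (ys @ [b])))"
    by (simp del: fun_upd_apply)
  then show ?case
    using Cons.IH[of "ys @ [b]"] by (simp add: msteps_Suc del: fun_upd_apply mstep.simps)
qed

text \<open>The tape holds \<open>ys @ zs\<close> while the control carries the symbol that belongs
  between them. What is still carried when the marker is reached is the old top of the stack; it is
  discarded, hence the \<open>tl\<close>.\<close>

lemma msteps_unshift_Some:
  "msteps p (length ys + 1) (Run k (Unshift r (Some c)), tape (s(r := ys @ zs)), int (length ys) - 1)
     (Run k Home, tape (s(r := tl (ys @ c # zs))), 0)"
proof (induction ys arbitrary: zs c rule: rev_induct)
  case Nil
  then show ?case by (simp add: msteps_Suc del: fun_upd_apply)
next
  case (snoc y ys)
  have "mstep p (Run k (Unshift r (Some c)), tape (s(r := ys @ y # zs)), int (length ys)) =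
    (Run k (Unshift r (Some y)), tape (s(r := ys @ c # zs)), int (length ys) - 1)"
    by (simp add: tape_write_mid del: fun_upd_apply)
  then show ?case
    using snoc.IH[of y "c # zs"] by (simp add: msteps_Suc del: fun_upd_apply mstep.simps)
qed

lemma msteps_unshift_None:
  "msteps p (length ys + 1) (Run k (Unshift r None), tape (s(r := ys)), int (length ys) - 1)
     (Run k Home, tape (s(r := tl ys)), 0)"
proof (cases ys rule: rev_cases)
  case Nil
  then show ?thesis by (simp add: msteps_Suc del: fun_upd_apply)
next
  case (snoc us u)
  have "mstep p (Run k (Unshift r None), tape (s(r := us @ [u])), int (length us)) =
    (Run k (Unshift r (Some u)), tape (s(r := us)), int (length us) - 1)"
    by (simp add: tape_erase_end del: fun_upd_apply)
  then show ?thesis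
    using msteps_unshift_Some[of p us k r u s "[]"] snoc
    by (simp add: msteps_Suc del: fun_upd_apply mstep.simps)
qed

lemma msteps_push:
  "\<exists>n \<le> 2 * length (s r) + 4. msteps p n (Run (Push r v # k) Home, tape s, 0)
     (Run k Home, tape (push_opt r (v (tops s)) s), 0)"
proof (cases "v (tops s)")
  case None
  then show ?thesis
    by (intro exI[of _ 1]) (simp add: msteps_Suc)
next
  case (Some a)
  have "msteps p (length (s r) + 1) (Run k (Shift r a), tape s, 0)
     (Run k Return, tape (s(r := a # s r)), int (length (s r)) - 1)"
    using msteps_shift[of p "s r" k r a s "[]"] by simp
  then have "msteps p ((length (s r) + 1) + (length (s r) + 1)) (Run k (Shift r a), tape s, 0)
     (Run k Home, tape (s(r := a # s r)), 0)"
    by (rule msteps_trans) (rule msteps_return)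
  then have "msteps p (Suc ((length (s r) + 1) + (length (s r) + 1))) (Run (Push r v # k) Home, tape s, 0)
     (Run k Home, tape (push_opt r (v (tops s)) s), 0)"
    using Some by (simp add: msteps_Suc)
  then show ?thesis by (intro exI conjI) (auto simp del: fun_upd_apply)
qed

lemma msteps_pop:
  "\<exists>n \<le> 2 * length (s r) + 4. msteps p n (Run (Pop r # k) Home, tape s, 0)
     (Run k Home, tape (s(r := tl (s r))), 0)"
proof -
  have "msteps p (length (s r) + 1) (Run k (Seek r), tape s, 0)
     (Run k (Unshift r None), tape s, int (length (s r)) - 1)"
    using msteps_seek[of p "s r" k r s "[]"] by simp
  moreover have "msteps p (length (s r) + 1) (Run k (Unshift r None), tape s, int (length (s r)) - 1)
     (Run k Home, tape (s(r := tl (s r))), 0)"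
    using msteps_unshift_None[of p "s r" k r s] by simp
  ultimately have "msteps p ((length (s r) + 1) + (length (s r) + 1)) (Run k (Seek r), tape s, 0)
     (Run k Home, tape (s(r := tl (s r))), 0)"
    by (rule msteps_trans)
  then have "msteps p (Suc ((length (s r) + 1) + (length (s r) + 1))) (Run (Pop r # k) Home, tape s, 0)
     (Run k Home, tape (s(r := tl (s r))), 0)"
    by (simp add: msteps_Suc)
  then show ?thesis by (intro exI conjI) (auto simp del: fun_upd_apply)
qed

text \<open>\<open>L\<close> bounds height plus remaining time. By \<open>exec_length\<close> this
  sum never grows during a run, so one \<open>L\<close> serves all nested commands, each of which
  costs at most one pass along a track and back.\<close>

lemma msteps_exec:
  assumes "exec q s t s'" "\<And>r. length (s r) + t \<le> L"
  shows "\<exists>n \<le> t * (2 * L + 4). msteps p n (Run (q # k) Home, tape s, 0) (Run k Home, tape s', 0)"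
  using assms
proof (induction arbitrary: k rule: exec.induct)
  case (exec_Skip s)
  show ?case by (intro exI[of _ 1]) (simp add: msteps_Suc)
next
  case (exec_Push r v s)
  have "2 * length (s r) + 4 \<le> 1 * (2 * L + 4)" using exec_Push(1)[of r] by simp
  then show ?case using msteps_push[of s r p v k] by (meson order_trans)
next
  case (exec_Pop r s)
  have "2 * length (s r) + 4 \<le> 1 * (2 * L + 4)" using exec_Pop(1)[of r] by simp
  then show ?case using msteps_pop[of s r p k] by (meson order_trans)
next
  case (exec_Seq a s t s' b t' s'')
  have 1: "length (s r) + t \<le> L" for r using exec_Seq.prems[of r] by simp
  have 2: "length (s' r) + t' \<le> L" for r
    using exec_Seq.prems[of r] exec_length[OF exec_Seq.hyps(1), of r] by simp
  obtain n1 where n1: "n1 \<le> t * (2 * L + 4)"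
    "msteps p n1 (Run (a # b # k) Home, tape s, 0) (Run (b # k) Home, tape s', 0)"
    using exec_Seq.IH(1)[OF 1] by blast
  obtain n2 where n2: "n2 \<le> t' * (2 * L + 4)"
    "msteps p n2 (Run (b # k) Home, tape s', 0) (Run k Home, tape s'', 0)"
    using exec_Seq.IH(2)[OF 2] by blast
  have "msteps p (Suc (n1 + n2)) (Run ((a ;; b) # k) Home, tape s, 0) (Run k Home, tape s'', 0)"
    using msteps_trans[OF n1(2) n2(2)] by (simp add: msteps_Suc)
  moreover have "Suc (n1 + n2) \<le> Suc (t + t') * (2 * L + 4)"
    using n1(1) n2(1) by (simp add: algebra_simps)
  ultimately show ?case by blast
next
  case (exec_CondT b s a t s' c)
  have 1: "length (s r) + t \<le> L" for r using exec_CondT.prems[of r] by simp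
  obtain n1 where n1: "n1 \<le> t * (2 * L + 4)"
    "msteps p n1 (Run (a # k) Home, tape s, 0) (Run k Home, tape s', 0)"
    using exec_CondT.IH[OF 1] by blast
  have "msteps p (Suc n1) (Run (Cond b a c # k) Home, tape s, 0) (Run k Home, tape s', 0)"
    using n1(2) exec_CondT.hyps(1) by (simp add: msteps_Suc)
  moreover have "Suc n1 \<le> Suc t * (2 * L + 4)"
    using n1(1) by (simp add: algebra_simps)
  ultimately show ?case by blast
next
  case (exec_CondF b s c t s' a)
  have 1: "length (s r) + t \<le> L" for r using exec_CondF.prems[of r] by simp
  obtain n1 where n1: "n1 \<le> t * (2 * L + 4)"
    "msteps p n1 (Run (c # k) Home, tape s, 0) (Run k Home, tape s', 0)"
    using exec_CondF.IH[OF 1] by blast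
  have "msteps p (Suc n1) (Run (Cond b a c # k) Home, tape s, 0) (Run k Home, tape s', 0)"
    using n1(2) exec_CondF.hyps(1) by (simp add: msteps_Suc)
  moreover have "Suc n1 \<le> Suc t * (2 * L + 4)"
    using n1(1) by (simp add: algebra_simps)
  ultimately show ?case by blast
next
  case (exec_WhileF b s a)
  then show ?case by (intro exI[of _ 1]) (simp add: msteps_Suc)
next
  case (exec_WhileT b s a t s' t' s'')
  have 1: "length (s r) + t \<le> L" for r using exec_WhileT.prems[of r] by simp
  have 2: "length (s' r) + t' \<le> L" for r
    using exec_WhileT.prems[of r] exec_length[OF exec_WhileT.hyps(2), of r] by simp
  obtain n1 where n1: "n1 \<le> t * (2 * L + 4)"
    "msteps p n1 (Run (a # While b a # k) Home, tape s, 0) (Run (While b a # k) Home, tape s', 0)"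
    using exec_WhileT.IH(1)[OF 1] by blast
  obtain n2 where n2: "n2 \<le> t' * (2 * L + 4)"
    "msteps p n2 (Run (While b a # k) Home, tape s', 0) (Run k Home, tape s'', 0)"
    using exec_WhileT.IH(2)[OF 2] by blast
  have "msteps p (Suc (n1 + n2)) (Run (While b a # k) Home, tape s, 0) (Run k Home, tape s'', 0)"
    using msteps_trans[OF n1(2) n2(2)] exec_WhileT.hyps(1) by (simp add: msteps_Suc)
  moreover have "Suc (n1 + n2) \<le> Suc (t + t') * (2 * L + 4)"
    using n1(1) n2(1) by (simp add: algebra_simps)
  ultimately show ?case by blast
qed

text \<open>The control state contains a list of commands, yet only finitely many lists are
  reachable from \<open>p # k\<close>: unfolding a loop puts the same \<open>While\<close> command
  back, so lists do not grow beyond the nesting of the program.\<close>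

fun conts :: "com \<Rightarrow> com list \<Rightarrow> com list set" where
  "conts (p ;; q) k = insert ((p ;; q) # k) (conts p (q # k) \<union> conts q k)"
| "conts (Cond b p q) k = insert (Cond b p q # k) (conts p k \<union> conts q k)"
| "conts (While b p) k = insert (While b p # k) (conts p (While b p # k))"
| "conts p k = {p # k}"

lemma conts_self [simp]: "p # k \<in> conts p k"
  by (cases p) auto

lemma finite_conts [simp]: "finite (conts p k)"
  by (induction p arbitrary: k) auto

lemma home_step_conts:
  "l \<in> conts p k \<Longrightarrow> \<exists>k' ph. home_step l f = Run k' ph \<and> k' \<in> insert k (conts p k)"
proof (induction p arbitrary: k)
  case (Push r v)
  then show ?case by (cases "v f") auto
next
  case (Seq p q)
  consider "l = (p ;; q) # k" | "l \<in> conts p (q # k)" | "l \<in> conts q k"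
    using Seq.prems by auto
  then show ?case
  proof cases
    case 2
    then show ?thesis using Seq.IH(1)[of "q # k"] conts_self[of q k] by fastforce
  next
    case 3
    then show ?thesis using Seq.IH(2)[of k] by fastforce
  qed simp
next
  case (Cond b p q)
  consider "l = Cond b p q # k" | "l \<in> conts p k" | "l \<in> conts q k"
    using Cond.prems by auto
  then show ?case
  proof cases
    case 2
    then show ?thesis using Cond.IH(1)[of k] by fastforce
  next
    case 3
    then show ?thesis using Cond.IH(2)[of k] by fastforce
  qed simp
next
  case (While b p)
  consider "l = While b p # k" | "l \<in> conts p (While b p # k)"
    using While.prems by auto
  then show ?case
  proof cases
    case 2
    then show ?thesis using While.IH[of "While b p # k"] by fastforce
  qed simp
qed auto

definition states :: "com \<Rightarrow> state set" where
  "states p = {Start, Mark, Acc, Rej} \<union> {Run k ph | k ph. k \<in> insert [] (conts p [])}"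

lemma trans_fun_states:
  assumes "q \<in> states p"
  shows "fst (trans_fun p q x) \<in> states p" "snd (snd (trans_fun p q x)) \<in> {-1, 0, 1}"
proof -
  have home: "home_step k f \<in> states p" if "k \<in> insert [] (conts p [])" for k f
  proof (cases "k = []")
    case False
    then show ?thesis using that home_step_conts[of k p "[]" f] by (auto simp: states_def)
  qed (simp add: states_def)
  show "fst (trans_fun p q x) \<in> states p"
  proof (cases q)
    case (Run k ph)
    then have "k \<in> insert [] (conts p [])" using assms by (auto simp: states_def)
    then show ?thesis unfolding Run using home[of k]
      by (cases "(k, ph, x)" rule: run_step.cases)
        (auto simp: states_def split: option.splits)
  qed (auto simp: states_def)
  show "snd (snd (trans_fun p q x)) \<in> {-1, 0, 1}"
  proof (cases q)
    case (Run k ph)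
    then show ?thesis
      by (cases "(k, ph, x)" rule: run_step.cases) (auto split: option.splits)
  qed auto
qed

section \<open>Finiteness of the state set and the tape alphabet\<close>

instance sym :: finite
proof
  have "x \<in> Bit ` UNIV \<union> {Op, Cl}" for x :: sym by (cases x) auto
  then have "(UNIV :: sym set) \<subseteq> Bit ` UNIV \<union> {Op, Cl}" by blast
  then show "finite (UNIV :: sym set)" by (rule finite_subset) simp
qed

instance reg :: finite
proof
  have "x \<in> {RA, RB, RC, RD}" for x :: reg by (cases x) auto
  then have "(UNIV :: reg set) \<subseteq> {RA, RB, RC, RD}" by blast
  then show "finite (UNIV :: reg set)" by (rule finite_subset) simp
qed

instance phase :: finite
proof
  have "ph \<in> {Home, Return} \<union> range (case_prod Shift) \<union> range Seek \<union> range (case_prod Unshift)"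
    for ph by (cases ph) (auto simp: image_iff)
  then have "(UNIV :: phase set) \<subseteq>
      {Home, Return} \<union> range (case_prod Shift) \<union> range Seek \<union> range (case_prod Unshift)"
    by blast
  then show "finite (UNIV :: phase set)" by (rule finite_subset) simp
qed

lemma finite_states: "finite (states p)"
proof -
  have "states p \<subseteq> {Start, Mark, Acc, Rej} \<union> case_prod Run ` (insert [] (conts p []) \<times> UNIV)"
    by (auto simp: states_def)
  then show ?thesis by (rule finite_subset) simp
qed

text \<open>The elements of \<open>xs\<close> receive the first numbers because the machine model
  prescribes the numbers of the start and halting states, of the blank and of the four input
  symbols.\<close>

lemma finite_numbering:
  assumes "finite A" "distinct xs" "set xs \<subseteq> A"
  shows "\<exists>(e :: 'a \<Rightarrow> nat) d N. (\<forall>a\<in>A. e a < N \<and> d (e a) = a) \<and> (\<forall>i<N. d i \<in> A) \<and>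
    (\<forall>i<length xs. e (xs ! i) = i) \<and> length xs \<le> N"
proof -
  obtain ys where ys: "set ys = A - set xs" "distinct ys"
    using finite_distinct_list[of "A - set xs"] assms(1) by auto
  define zs where "zs = xs @ ys"
  have zs: "distinct zs" "set zs = A"
    using assms ys by (auto simp: zs_def)
  then have bij: "bij_betw ((!) zs) {..<length zs} A"
    by (auto intro: bij_betw_nth)
  define e where "e = the_inv_into {..<length zs} ((!) zs)"
  show ?thesis
  proof (intro exI[of _ e] exI[of _ "(!) zs"] exI[of _ "length zs"] conjI ballI allI impI)
    show "e a < length zs" if "a \<in> A" for a
      using that bij bij_betw_the_inv_into[OF bij] by (auto simp: e_def bij_betw_def)
    show "zs ! e a = a" if "a \<in> A" for a
      using that bij by (auto simp: e_def bij_betw_def f_the_inv_into_f)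
    show "zs ! i \<in> A" if "i < length zs" for i
      using that zs by auto
    show "e (xs ! i) = i" if "i < length xs" for i
    proof -
      have "xs ! i = zs ! i" "i < length zs" using that by (auto simp: zs_def nth_append)
      then show ?thesis using bij by (auto simp: e_def bij_betw_def the_inv_into_f_f)
    qed
  qed (simp add: zs_def)
qed

section \<open>From the abstract machine to a machine on natural numbers\<close>

fun sym_nat :: "sym \<Rightarrow> nat" where
  "sym_nat (Bit False) = 1"
| "sym_nat (Bit True) = 2"
| "sym_nat Op = 3"
| "sym_nat Cl = 4"

definition init_stacks :: "sym list \<Rightarrow> stacks" where
  "init_stacks x = (\<lambda>r. if r = RA then x else [])"

definition input_cell :: "sym option \<Rightarrow> cell" where
  "input_cell a = Some (\<lambda>r. if r = RA then a else None)"

lemma ex_tm_simulating: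
  "\<exists>M eq es. tm_wf M \<and> eq Start = 0 \<and> eq Acc = 1 \<and> eq Rej = 2 \<and>
     es (input_cell None) = 0 \<and> (\<forall>a. es (input_cell (Some a)) = sym_nat a) \<and>
     (\<forall>q tp h. q \<in> states p \<longrightarrow>
       tm_step M (eq q, es \<circ> tp, h) =
         (case mstep p (q, tp, h) of (q', tp', h') \<Rightarrow> (eq q', es \<circ> tp', h')))"
proof -
  have "distinct [Start, Acc, Rej]" "set [Start, Acc, Rej] \<subseteq> states p"
    by (auto simp: states_def)
  from finite_numbering[OF finite_states this] obtain eq dq N where
    q: "\<forall>a\<in>states p. eq a < N \<and> dq (eq a) = a" "\<forall>i<N. dq i \<in> states p"
    and eq_nth: "\<forall>i<length [Start, Acc, Rej]. eq ([Start, Acc, Rej] ! i) = i"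
    and N: "length [Start, Acc, Rej] \<le> N"
    by blast
  define xs where
    "xs = map input_cell [None, Some (Bit False), Some (Bit True), Some Op, Some Cl]"
  have inj: "input_cell a = input_cell b \<longleftrightarrow> a = b" for a b
    by (auto simp: input_cell_def fun_eq_iff)
  have "distinct xs" "set xs \<subseteq> UNIV"
    by (auto simp: xs_def inj)
  from finite_numbering[OF finite_UNIV this] obtain es ds S where
    s: "\<forall>a\<in>UNIV. es a < S \<and> ds (es a) = a"
    and es_nth: "\<forall>i<length xs. es (xs ! i) = i" and S: "length xs \<le> S"
    by blast
  define \<delta> where "\<delta> q s = (case trans_fun p (dq q) (ds s) of (q', x, m) \<Rightarrow> (eq q', es x, m))"
    for q s
  have eqs: "eq Start = 0" "eq Acc = 1" "eq Rej = 2"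
    using eq_nth[rule_format, of 0] eq_nth[rule_format, of 1] eq_nth[rule_format, of 2]
    by simp_all
  have ess: "es (input_cell None) = 0" "es (input_cell (Some (Bit False))) = 1"
    "es (input_cell (Some (Bit True))) = 2" "es (input_cell (Some Op)) = 3"
    "es (input_cell (Some Cl)) = 4"
    using es_nth[rule_format, of 0] es_nth[rule_format, of 1] es_nth[rule_format, of 2]
      es_nth[rule_format, of 3] es_nth[rule_format, of 4]
    by (simp_all add: xs_def)
  have mem: "Acc \<in> states p" "Rej \<in> states p" by (auto simp: states_def)
  show ?thesis
  proof (intro exI[of _ "(N, S, \<delta>)"] exI[of _ eq] exI[of _ es] conjI allI impI)
    show "tm_wf (N, S, \<delta>)"
    proof -
      have "case \<delta> i j of (q', s', m) \<Rightarrow> q' < N \<and> s' < S \<and> m \<in> {-1, 0, 1}" if "i < N" for i j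
      proof -
        obtain q' x m where eq: "trans_fun p (dq i) (ds j) = (q', x, m)" by (metis prod_cases3)
        then have "q' \<in> states p" "m \<in> {-1, 0, 1}"
          using trans_fun_states[OF q(2)[rule_format, OF that], of "ds j"] by simp_all
        then show ?thesis using q(1) s eq by (simp add: \<delta>_def)
      qed
      then show ?thesis using N S by (simp add: tm_wf_def xs_def)
    qed
    show "es (input_cell (Some a)) = sym_nat a" for a
      using ess by (cases a rule: sym_nat.cases) auto
    show "tm_step (N, S, \<delta>) (eq q, es \<circ> tp, h) =
         (case mstep p (q, tp, h) of (q', tp', h') \<Rightarrow> (eq q', es \<circ> tp', h'))"
      if "q \<in> states p" for q tp h
    proof (cases "q = Acc \<or> q = Rej")
      case True
      then show ?thesis using eqs by (auto simp: tm_step_def)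
    next
      case False
      \<comment> \<open>\<open>tm_step\<close> freezes the states 1 and 2, so no other state may
        share these numbers; the decoder \<open>dq\<close> rules this out.\<close>
      then have "eq q \<noteq> 1" "eq q \<noteq> 2"
        using q(1) that mem eqs by metis+
      then show ?thesis
        using q(1) that s
        by (simp add: tm_step_def \<delta>_def fun_upd_comp split: prod.split)
    qed
  qed (use eqs ess in auto)
qed

lemma mstep_states: "q \<in> states p \<Longrightarrow> fst (mstep p (q, tp, h)) \<in> states p"
  using trans_fun_states(1)[of q p "tp h"] by (auto split: prod.splits)

text \<open>The 3 additional steps are the two that write the marker and return, and the one that
  turns the top of \<open>RA\<close> into a verdict. Any larger \<open>m\<close> gives the same
  state because \<open>Acc\<close> and \<open>Rej\<close> are fixed points.\<close>

theorem ex_tm_exec: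
  fixes p :: com
  obtains M where "tm_wf M"
    "\<And>x t s' m. exec p (init_stacks x) t s' \<Longrightarrow> t * (2 * (length x + t) + 4) + 3 \<le> m \<Longrightarrow>
       tm_state_after M (map sym_nat x) m = (if tops s' RA = Some Cl then 2 else 1)"
proof -
  obtain M eq es where M: "tm_wf M" "eq Start = 0" "eq Acc = 1" "eq Rej = 2"
    "es (input_cell None) = 0" "\<forall>a. es (input_cell (Some a)) = sym_nat a"
    "\<forall>q tp h. q \<in> states p \<longrightarrow>
       tm_step M (eq q, es \<circ> tp, h) =
         (case mstep p (q, tp, h) of (q', tp', h') \<Rightarrow> (eq q', es \<circ> tp', h'))"
    using ex_tm_simulating[of p] by (elim exE conjE)
  define lift where "lift c = (case c of (q, tp, h) \<Rightarrow> (eq q, es \<circ> tp, h))"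
    for c :: config
  have sim: "fst ((mstep p ^^ n) c) \<in> states p \<and> (tm_step M ^^ n) (lift c) = lift ((mstep p ^^ n) c)"
    if "fst c \<in> states p" for n c
  proof (induction n)
    case 0
    then show ?case using that by simp
  next
    case (Suc n)
    obtain q tp h where c: "(mstep p ^^ n) c = (q, tp, h)" by (metis prod_cases3)
    then have "q \<in> states p" using Suc by simp
    then have "fst (mstep p (q, tp, h)) \<in> states p" "tm_step M (lift (q, tp, h)) = lift (mstep p (q, tp, h))"
      using M(7)[rule_format, of q tp h] mstep_states[of q p tp h] by (simp_all only: lift_def prod.case)
    then show ?case using Suc c by (simp del: mstep.simps)
  qed
  show ?thesis
  proof (rule that[of M, OF M(1)])
    fix x t s' m
    assume ex: "exec p (init_stacks x) t s'" and m: "t * (2 * (length x + t) + 4) + 3 \<le> m"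
    define tp0 where "tp0 i = (if i < 0 then input_cell None
      else input_cell (if nat i < length x then Some (x ! nat i) else None))" for i :: int
    have init: "tm_init (map sym_nat x) = lift (Start, tp0, 0)"
      using M(2,5,6) by (simp add: tm_init_def lift_def tp0_def fun_eq_iff nat_less_iff)
    have tp1: "tp0(-1 := None) = tape (init_stacks x)"
      by (auto simp: tp0_def tape_def init_stacks_def cell_of_def input_cell_def fun_eq_iff)
    have len: "length (init_stacks x r) + t \<le> length x + t" for r
      by (simp add: init_stacks_def)
    have "msteps p 2 (Start, tp0, 0) (Run [p] Home, tape (init_stacks x), 0)"
      by (simp add: msteps_Suc numeral_2_eq_2 tp1 del: fun_upd_apply)
    moreover obtain n where n: "n \<le> t * (2 * (length x + t) + 4)"
      "msteps p n (Run [p] Home, tape (init_stacks x), 0) (Run [] Home, tape s', 0)"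
      using msteps_exec[OF ex len, of p "[]"] by blast
    moreover define qf where "qf = (if tops s' RA = Some Cl then Rej else Acc)"
    have "msteps p 1 (Run [] Home, tape s', 0) (qf, tape s', 0)"
      by (simp add: msteps_Suc qf_def)
    ultimately have "msteps p (2 + n + 1) (Start, tp0, 0) (qf, tape s', 0)"
      using msteps_trans by blast
    moreover have "msteps p j (qf, tape s', 0) (qf, tape s', 0)" for j
      by (induction j) (auto simp: msteps_Suc qf_def)
    ultimately have "msteps p ((2 + n + 1) + (m - (2 + n + 1))) (Start, tp0, 0) (qf, tape s', 0)"
      using msteps_trans by blast
    moreover have "(2 + n + 1) + (m - (2 + n + 1)) = m" using n(1) m by linarith
    ultimately have "(mstep p ^^ m) (Start, tp0, 0) = (qf, tape s', 0)"
      by (simp only: msteps_def)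
    moreover have "Start \<in> states p" by (simp add: states_def)
    ultimately have "(tm_step M ^^ m) (tm_init (map sym_nat x)) = lift (qf, tape s', 0)"
      using sim[of "(Start, tp0, 0)" m] init by simp
    then show "tm_state_after M (map sym_nat x) m = (if tops s' RA = Some Cl then 2 else 1)"
      using M(3,4) by (auto simp: tm_state_after_def lift_def qf_def)
  qed
qed

section \<open>Tree-valued stacks\<close>

text \<open>Trees in prefix code: consing is pushing \<^const>\<open>Op\<close>, and popping it splits a pair.\<close>

datatype tree = TNil | TBit bool tree | TCons tree tree

fun code :: "tree \<Rightarrow> sym list" where
  "code TNil = [Cl]"
| "code (TBit b t) = Bit b # code t"
| "code (TCons t u) = Op # code t @ code u"

text \<open>Prefix-freeness is the form of injectivity that survives induction: inside a pair the
  code of the first tree is followed by that of the second.\<close>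

lemma code_append_inj: "code t @ xs = code u @ ys \<Longrightarrow> t = u \<and> xs = ys"
proof (induction t arbitrary: u xs ys)
  case TNil
  then show ?case by (cases u) auto
next
  case (TBit b t)
  then show ?case by (cases u) auto
next
  case T: (TCons t1 t2)
  show ?case
  proof (cases u)
    case (TCons u1 u2)
    then have "code t1 @ (code t2 @ xs) = code u1 @ (code u2 @ ys)" using T.prems by simp
    then have "t1 = u1 \<and> code t2 @ xs = code u2 @ ys" by (rule T.IH(1))
    then show ?thesis using T.IH(2)[of xs u2 ys] TCons by simp
  qed (use T.prems in auto)
qed

lemma code_inj: "code t = code u \<longleftrightarrow> t = u"
  using code_append_inj[of t "[]" u "[]"] by auto

definition runs :: "com \<Rightarrow> stacks \<Rightarrow> nat \<Rightarrow> stacks \<Rightarrow> bool" where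
  "runs p s T s' \<longleftrightarrow> (\<exists>t\<le>T. exec p s t s')"

lemma runs_mono: "runs p s T s' \<Longrightarrow> T \<le> T' \<Longrightarrow> runs p s T' s'"
  unfolding runs_def by (meson order_trans)

lemma runs_Skip: "runs Skip s 1 s"
  unfolding runs_def by (intro exI[of _ 1]) (simp add: exec_Skip[simplified])

lemma runs_Push: "push_opt r (v (tops s)) s = s' \<Longrightarrow> runs (Push r v) s 1 s'"
  unfolding runs_def using exec_Push[of r v s] by blast

lemma runs_Pop: "s(r := tl (s r)) = s' \<Longrightarrow> runs (Pop r) s 1 s'"
  unfolding runs_def using exec_Pop[of r s] by blast

lemma runs_Seq: "runs p s T s1 \<Longrightarrow> runs q s1 T' s2 \<Longrightarrow> runs (p ;; q) s (Suc (T + T')) s2"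
  unfolding runs_def by (meson exec_Seq add_mono Suc_le_mono)

lemma runs_Cond:
  "runs (if b (tops s) then p else q) s T s' \<Longrightarrow> runs (Cond b p q) s (Suc T) s'"
  unfolding runs_def by (auto split: if_splits intro: exec_CondT exec_CondF)

lemma runs_WhileF: "\<not> b (tops s) \<Longrightarrow> runs (While b p) s 1 s"
  unfolding runs_def using exec_WhileF by blast

lemma runs_WhileT:
  "b (tops s) \<Longrightarrow> runs p s T s1 \<Longrightarrow> runs (While b p) s1 T' s2 \<Longrightarrow>
    runs (While b p) s (Suc (T + T')) s2"
  unfolding runs_def by (meson exec_WhileT add_mono Suc_le_mono)

lemma runs_length: "runs p s T s' \<Longrightarrow> length (s' r) \<le> length (s r) + T"
  unfolding runs_def using exec_length by (meson add_left_mono order_trans)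

lemma tops_apply: "tops s r = (case s r of [] \<Rightarrow> None | a # _ \<Rightarrow> Some a)"
  by (simp add: cell_of_def split: list.splits)

definition stk :: "sym list \<Rightarrow> sym list \<Rightarrow> sym list \<Rightarrow> sym list \<Rightarrow> stacks" where
  "stk a b c d r = (case r of RA \<Rightarrow> a | RB \<Rightarrow> b | RC \<Rightarrow> c | RD \<Rightarrow> d)"

lemma stk_simps [simp]:
  "stk a b c d RA = a" "stk a b c d RB = b" "stk a b c d RC = c" "stk a b c d RD = d"
  "(stk a b c d)(RA := x) = stk x b c d" "(stk a b c d)(RB := x) = stk a x c d"
  "(stk a b c d)(RC := x) = stk a b x d" "(stk a b c d)(RD := x) = stk a b c x"
  by (auto simp: stk_def fun_eq_iff split: reg.splits)

lemma init_stacks_stk: "init_stacks x = stk x [] [] []"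
  by (auto simp: init_stacks_def stk_def fun_eq_iff split: reg.splits)

subsection \<open>Programs on the top trees of the main stack\<close>

definition move :: "reg \<Rightarrow> reg \<Rightarrow> com" where
  "move i j = While (\<lambda>f. f i \<noteq> None) (Push j (\<lambda>f. f i) ;; Pop i)"

lemma runs_move:
  assumes "i \<noteq> j"
  shows "runs (move i j) s (4 * length (s i) + 1) (s(i := [], j := rev (s i) @ s j))"
proof (induction "s i" arbitrary: s)
  case Nil
  then have r: "runs (move i j) s 1 s"
    unfolding move_def by (intro runs_WhileF) (simp add: tops_apply)
  have eq: "s(i := [], j := rev (s i) @ s j) = s"
    using Nil by (auto simp: fun_eq_iff)
  show ?case unfolding eq by (rule runs_mono[OF r]) simp
next
  case (Cons a xs)
  let ?s = "s(i := xs, j := a # s j)"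
  have "runs (Push j (\<lambda>f. f i) ;; Pop i) s (Suc (1 + 1)) ?s"
    by (rule runs_Seq[OF runs_Push[OF refl] runs_Pop])
      (use Cons(2)[symmetric] assms in \<open>auto simp: tops_apply fun_eq_iff\<close>)
  moreover have "runs (move i j) ?s (4 * length xs + 1) (s(i := [], j := rev (s i) @ s j))"
  proof -
    have "?s(i := [], j := rev (?s i) @ ?s j) = s(i := [], j := rev (s i) @ s j)"
      using Cons(2)[symmetric] assms by (auto simp: fun_eq_iff)
    then show ?thesis using Cons(1)[of ?s] assms by simp
  qed
  ultimately have "runs (move i j) s (Suc (Suc (1 + 1) + (4 * length xs + 1)))
      (s(i := [], j := rev (s i) @ s j))"
    unfolding move_def
    by (intro runs_WhileT) (use Cons(2)[symmetric] in \<open>auto simp: tops_apply\<close>)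
  then show ?case by (rule runs_mono) (simp add: Cons(2)[symmetric])
qed

definition clear :: "reg \<Rightarrow> com" where
  "clear r = While (\<lambda>f. f r \<noteq> None) (Pop r)"

lemma runs_clear: "runs (clear r) s (2 * length (s r) + 1) (s(r := []))"
proof (induction "s r" arbitrary: s)
  case Nil
  then have r: "runs (clear r) s 1 s"
    unfolding clear_def by (intro runs_WhileF) (simp add: tops_apply)
  have eq: "s(r := []) = s"
    using Nil by (auto simp: fun_eq_iff)
  show ?case unfolding eq by (rule runs_mono[OF r]) simp
next
  case (Cons a xs)
  have "runs (clear r) (s(r := xs)) (2 * length xs + 1) (s(r := []))"
    using Cons(1)[of "s(r := xs)"] by simp
  then have "runs (clear r) s (Suc (1 + (2 * length xs + 1))) (s(r := []))"
    unfolding clear_def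
    by (intro runs_WhileT[OF _ runs_Pop]) (use Cons(2)[symmetric] in \<open>auto simp: tops_apply\<close>)
  then show ?case by (rule runs_mono) (simp add: Cons(2)[symmetric])
qed

text \<open>The height of stack \<^const>\<open>RD\<close> is the number of trees that are still to be read.\<close>

definition split_loop :: "reg \<Rightarrow> com" where
  "split_loop j = While (\<lambda>f. f RD \<noteq> None)
     (Push j (\<lambda>f. f RA) ;;
      Cond (\<lambda>f. f RA = Some Op) (Push RD (\<lambda>_. Some Op))
        (Cond (\<lambda>f. f RA = Some Cl) (Pop RD) Skip) ;;
      Pop RA)"

text \<open>Stated backwards, from the run of the rest of the loop to a run with one more symbol, to
  match the form in which \<open>runs_split_loop\<close> treats whole trees.\<close>

lemma runs_split_loop_iter:
  assumes j: "j \<noteq> RA" "j \<noteq> RD" and s: "s RA = a # u" "s RD = d # ds"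
    and rest: "runs (split_loop j)
      (s(RA := u, j := a # s j, RD := (case a of Op \<Rightarrow> Op # d # ds | Cl \<Rightarrow> ds | _ \<Rightarrow> d # ds))) T s'"
  shows "runs (split_loop j) s (T + 10) s'"
proof -
  let ?D = "case a of Op \<Rightarrow> Op # d # ds | Cl \<Rightarrow> ds | _ \<Rightarrow> d # ds"
  let ?s1 = "s(j := a # s j)"
  let ?c = "Cond (\<lambda>f. f RA = Some Op) (Push RD (\<lambda>_. Some Op))
        (Cond (\<lambda>f. f RA = Some Cl) (Pop RD) Skip)"
  have "runs (Push j (\<lambda>f. f RA)) s 1 ?s1"
    by (rule runs_Push) (use s in \<open>simp add: tops_apply\<close>)
  moreover have "runs ?c ?s1 3 (?s1(RD := ?D))"
  proof (cases a)
    case (Bit b)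
    have "runs ?c ?s1 (Suc (Suc 1)) ?s1"
      by (rule runs_Cond) (use Bit s j in \<open>simp add: tops_apply runs_Cond runs_Skip[simplified]\<close>)
    then show ?thesis using Bit s j by (simp add: numeral_3_eq_3 fun_upd_idem)
  next
    case Op
    have "runs (Push RD (\<lambda>_. Some Op)) ?s1 1 (?s1(RD := ?D))"
      by (rule runs_Push) (use Op s j in simp)
    then have "runs ?c ?s1 (Suc 1) (?s1(RD := ?D))"
      by (intro runs_Cond) (use Op s j in \<open>simp add: tops_apply\<close>)
    then show ?thesis by (rule runs_mono) simp
  next
    case Cl
    have "runs (Pop RD) ?s1 1 (?s1(RD := ?D))"
      by (rule runs_Pop) (use Cl s j in simp)
    then have "runs ?c ?s1 (Suc (Suc 1)) (?s1(RD := ?D))"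
      by (intro runs_Cond) (use Cl s j in \<open>simp add: tops_apply runs_Cond\<close>)
    then show ?thesis by (rule runs_mono) simp
  qed
  moreover have "runs (Pop RA) (?s1(RD := ?D)) 1 (s(RA := u, j := a # s j, RD := ?D))"
    by (rule runs_Pop) (use s j in \<open>auto simp: fun_eq_iff\<close>)
  ultimately have "runs (Push j (\<lambda>f. f RA) ;; ?c ;; Pop RA) s (Suc (1 + Suc (3 + 1)))
      (s(RA := u, j := a # s j, RD := ?D))"
    by (intro runs_Seq)
  then have "runs (split_loop j) s (Suc (Suc (1 + Suc (3 + 1)) + T)) s'"
    using rest s unfolding split_loop_def by (intro runs_WhileT) (auto simp: tops_apply)
  then show ?thesis by (rule runs_mono) simp
qed

text \<open>A flat loop is analysed along a recursive structure. Reading \<open>x\<close> discharges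
  exactly one entry of \<open>RD\<close>, and \<open>T\<close> is the time for the rest of the loop;
  for \<open>TCons\<close> the run on the second half is taken as the rest of the run on the first
  half.\<close>

lemma runs_split_loop:
  assumes j: "j \<noteq> RA" "j \<noteq> RD"
  shows "s RA = code x @ u \<Longrightarrow> s RD = d # ds \<Longrightarrow>
    runs (split_loop j) (s(RA := u, j := rev (code x) @ s j, RD := ds)) T s' \<Longrightarrow>
    runs (split_loop j) s (T + 10 * length (code x)) s'"
proof (induction x arbitrary: s u d ds T)
  case TNil
  have "runs (split_loop j) s (T + 10) s'"
    by (rule runs_split_loop_iter[OF j, of s Cl u d ds]) (use TNil in \<open>simp_all del: fun_upd_apply\<close>)
  then show ?case by simp
next
  case (TBit b x)
  let ?s1 = "s(RA := code x @ u, j := Bit b # s j, RD := d # ds)"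
  have "runs (split_loop j) ?s1 (T + 10 * length (code x)) s'"
  proof (rule TBit.IH)
    have eq: "?s1(RA := u, j := rev (code x) @ ?s1 j, RD := ds) =
        s(RA := u, j := rev (code (TBit b x)) @ s j, RD := ds)"
      using j by (auto simp: fun_eq_iff)
    show "runs (split_loop j) (?s1(RA := u, j := rev (code x) @ ?s1 j, RD := ds)) T s'"
      unfolding eq by (rule TBit.prems(3))
  qed (use j in auto)
  then show ?case
    using runs_split_loop_iter[OF j, of s "Bit b" "code x @ u" d ds "T + 10 * length (code x)" s'] TBit.prems
    by (simp add: algebra_simps)
next
  case (TCons x y)
  let ?s1 = "s(RA := code x @ code y @ u, j := Op # s j, RD := Op # d # ds)"
  let ?s2 = "?s1(RA := code y @ u, j := rev (code x) @ ?s1 j, RD := d # ds)"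
  have "runs (split_loop j) ?s2 (T + 10 * length (code y)) s'"
  proof (rule TCons.IH(2))
    have eq: "?s2(RA := u, j := rev (code y) @ ?s2 j, RD := ds) =
        s(RA := u, j := rev (code (TCons x y)) @ s j, RD := ds)"
      using j by (auto simp: fun_eq_iff)
    show "runs (split_loop j) (?s2(RA := u, j := rev (code y) @ ?s2 j, RD := ds)) T s'"
      unfolding eq by (rule TCons.prems(3))
  qed (use j in auto)
  then have "runs (split_loop j) ?s1 (T + 10 * length (code y) + 10 * length (code x)) s'"
    by (rule TCons.IH(1)[rotated 2]) (use j in auto)
  then show ?case
    using runs_split_loop_iter[OF j, of s Op "code x @ code y @ u" d ds
        "T + 10 * length (code y) + 10 * length (code x)" s'] TCons.prems
    by (simp add: algebra_simps)
qed

definition split :: "reg \<Rightarrow> com" where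
  "split j = Push RD (\<lambda>_. Some Op) ;; split_loop j"

lemma runs_split:
  assumes j: "j \<noteq> RA" "j \<noteq> RD" and s: "s RA = code x @ u" "s RD = []"
  shows "runs (split j) s (10 * length (code x) + 3) (s(RA := u, j := rev (code x) @ s j))"
proof -
  let ?s1 = "s(RD := [Op])" and ?s' = "s(RA := u, j := rev (code x) @ s j)"
  have "runs (split_loop j) ?s' 1 ?s'"
    unfolding split_loop_def by (rule runs_WhileF) (use s j in \<open>simp add: tops_apply\<close>)
  moreover have "?s1(RA := u, j := rev (code x) @ ?s1 j, RD := []) = ?s'"
    using s j by (auto simp: fun_eq_iff)
  ultimately have "runs (split_loop j) ?s1 (1 + 10 * length (code x)) ?s'"
    by (intro runs_split_loop[OF j, where u = u and d = Op and ds = "[]"]) (use s in auto)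
  then have "runs (split j) s (Suc (1 + (1 + 10 * length (code x)))) ?s'"
    unfolding split_def by (intro runs_Seq[OF runs_Push]) (use s in auto)
  then show ?thesis by (rule runs_mono) simp
qed

lemma runs_split_RB:
  "runs (split RB) (stk (code x @ u) b c []) (10 * length (code x) + 3) (stk u (rev (code x) @ b) c [])"
  using runs_split[of RB "stk (code x @ u) b c []" x u] by simp

lemma runs_split_RC:
  "runs (split RC) (stk (code x @ u) b c []) (10 * length (code x) + 3) (stk u b (rev (code x) @ c) [])"
  using runs_split[of RC "stk (code x @ u) b c []" x u] by simp

definition dropc :: com where
  "dropc = split RB ;; clear RB"

lemma runs_dropc: "runs dropc (stk (code x @ u) [] [] []) (20 * length (code x) + 20) (stk u [] [] [])"
proof -
  have "runs dropc (stk (code x @ u) [] [] [])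
      (Suc ((10 * length (code x) + 3) + (2 * length (code x) + 1))) (stk u [] [] [])"
    unfolding dropc_def
    using runs_Seq[OF runs_split_RB[of x u "[]" "[]"] runs_clear[of RB]] by simp
  then show ?thesis by (rule runs_mono) simp
qed

definition swapc :: com where
  "swapc = split RB ;; split RC ;; move RB RA ;; move RC RA"

lemma runs_swapc:
  "runs swapc (stk (code x @ code y @ u) [] [] []) (20 * length (code x) + 20 * length (code y) + 20)
     (stk (code y @ code x @ u) [] [] [])"
proof -
  have "runs swapc (stk (code x @ code y @ u) [] [] [])
    (Suc ((10 * length (code x) + 3) + Suc ((10 * length (code y) + 3) +
      Suc ((4 * length (code x) + 1) + (4 * length (code y) + 1)))))
    (stk (code y @ code x @ u) [] [] [])"
    unfolding swapc_def
    apply (intro runs_Seq)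
       apply (rule runs_split_RB)
      apply (rule runs_split_RC)
    using runs_move[of RB RA "stk u (rev (code x) @ []) (rev (code y) @ []) []"] apply simp
    using runs_move[of RC RA "stk (code x @ u) [] (rev (code y) @ []) []"] by simp
  then show ?thesis by (rule runs_mono) simp
qed

definition copy_loop :: com where
  "copy_loop = While (\<lambda>f. f RB \<noteq> None) (Push RA (\<lambda>f. f RB) ;; Push RC (\<lambda>f. f RB) ;; Pop RB)"

lemma runs_copy_loop:
  "runs copy_loop (stk a b c d) (6 * length b + 1) (stk (rev b @ a) [] (rev b @ c) d)"
proof (induction b arbitrary: a c)
  case Nil
  have "runs copy_loop (stk a [] c d) 1 (stk a [] c d)"
    unfolding copy_loop_def by (rule runs_WhileF) (simp add: tops_apply)
  then show ?case by simp
next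
  case (Cons x b)
  have "runs (Push RA (\<lambda>f. f RB) ;; Push RC (\<lambda>f. f RB) ;; Pop RB) (stk a (x # b) c d)
    (Suc (1 + Suc (1 + 1))) (stk (x # a) b (x # c) d)"
    by (intro runs_Seq runs_Push runs_Pop) (auto simp: tops_apply)
  then have "runs copy_loop (stk a (x # b) c d) (Suc (Suc (1 + Suc (1 + 1)) + (6 * length b + 1)))
     (stk (rev (x # b) @ a) [] (rev (x # b) @ c) d)"
    using Cons[of "x # a" "x # c"] unfolding copy_loop_def
    by (intro runs_WhileT) (auto simp: tops_apply)
  then show ?case by (rule runs_mono) simp
qed

text \<open>\<open>copy_loop\<close> restores the original on \<open>RA\<close> and leaves the copy
  on \<open>RC\<close> in reading order. Moving it straight to \<open>RA\<close> would reverse it,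
  hence the detour through \<open>RB\<close>.\<close>

definition dupc :: com where
  "dupc = split RB ;; copy_loop ;; move RC RB ;; move RB RA"

lemma runs_dupc:
  "runs dupc (stk (code x @ u) [] [] []) (30 * length (code x) + 30)
     (stk (code x @ code x @ u) [] [] [])"
proof -
  have "runs dupc (stk (code x @ u) [] [] [])
    (Suc ((10 * length (code x) + 3) + Suc ((6 * length (rev (code x) @ []) + 1) +
      Suc ((4 * length (code x) + 1) + (4 * length (code x) + 1)))))
    (stk (code x @ code x @ u) [] [] [])"
    unfolding dupc_def
    apply (intro runs_Seq)
       apply (rule runs_split_RB)
      apply (rule runs_copy_loop)
    using runs_move[of RC RB "stk (rev (rev (code x) @ []) @ u) [] (rev (rev (code x) @ []) @ []) []"] apply simp
    using runs_move[of RB RA "stk (code x @ u) (rev (code x)) [] []"] by simp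
  then show ?thesis by (rule runs_mono) simp
qed

definition strip_loop :: com where
  "strip_loop = While (\<lambda>f. f RB \<noteq> None \<and> f RB = f RC) (Pop RB ;; Pop RC)"

text \<open>Equal tops are cancelled in pairs, so the two words agree iff nothing is left on either
  side. The lengths of the remainders bound the time for clearing them in
  \<open>eqc\<close>.\<close>

lemma runs_strip_loop:
  "\<exists>b' c'. runs strip_loop (stk a b c d) (4 * length b + 1) (stk a b' c' d) \<and>
     (b' = [] \<and> c' = [] \<longleftrightarrow> b = c) \<and> length b' \<le> length b \<and> length c' \<le> length c"
proof (induction b arbitrary: c)
  case Nil
  have "runs strip_loop (stk a [] c d) 1 (stk a [] c d)"
    unfolding strip_loop_def by (rule runs_WhileF) (simp add: tops_apply)
  then show ?case by (intro exI[of _ "[]"] exI[of _ c]) auto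
next
  case (Cons x b)
  show ?case
  proof (cases "\<exists>c1. c = x # c1")
    case False
    then have "runs strip_loop (stk a (x # b) c d) 1 (stk a (x # b) c d)"
      unfolding strip_loop_def
      by (intro runs_WhileF) (auto simp: tops_apply split: list.splits)
    then have "runs strip_loop (stk a (x # b) c d) (4 * length (x # b) + 1) (stk a (x # b) c d)"
      by (rule runs_mono) simp
    then show ?thesis using False by (intro exI[of _ "x # b"] exI[of _ c]) auto
  next
    case True
    then obtain c1 where c: "c = x # c1" by blast
    obtain b' c' where IH: "runs strip_loop (stk a b c1 d) (4 * length b + 1) (stk a b' c' d)"
      "b' = [] \<and> c' = [] \<longleftrightarrow> b = c1" "length b' \<le> length b" "length c' \<le> length c1"
      using Cons by blast
    have "runs (Pop RB ;; Pop RC) (stk a (x # b) c d) (Suc (1 + 1)) (stk a b c1 d)"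
      by (intro runs_Seq runs_Pop) (auto simp: c)
    then have r: "runs strip_loop (stk a (x # b) c d) (Suc (Suc (1 + 1) + (4 * length b + 1)))
       (stk a b' c' d)"
      using IH(1) unfolding strip_loop_def
      by (intro runs_WhileT) (auto simp: tops_apply c)
    have "runs strip_loop (stk a (x # b) c d) (4 * length (x # b) + 1) (stk a b' c' d)"
      by (rule runs_mono[OF r]) simp
    moreover have "b' = [] \<and> c' = [] \<longleftrightarrow> x # b = c" using IH(2) c by simp
    moreover have "length b' \<le> length (x # b)" "length c' \<le> length c" using IH(3,4) c by simp_all
    ultimately show ?thesis by blast
  qed
qed

section \<open>Encoded data\<close>

class treelike =
  fixes to_tree :: "'a \<Rightarrow> tree"
  assumes to_tree_inj: "to_tree x = to_tree y \<Longrightarrow> x = y"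

text \<open>The first symbol of the code already separates the truth values, and \<open>Cl\<close>
  alone is \<open>False\<close>. The final test of the machine and the branching in
  \<open>ptime_if\<close> look at this symbol only.\<close>

instantiation bool :: treelike
begin
definition "to_tree b = (if b then TBit False TNil else TNil)"
instance by standard (auto simp: to_tree_bool_def split: if_splits)
end

fun nat_tree :: "nat \<Rightarrow> tree" where
  "nat_tree n = (if n = 0 then TNil else TBit (odd n) (nat_tree (n div 2)))"

declare nat_tree.simps [simp del]

lemma nat_tree_inj: "nat_tree m = nat_tree n \<Longrightarrow> m = n"
proof (induction m arbitrary: n rule: nat_tree.induct)
  case (1 m)
  show ?case
  proof (cases "m = 0 \<or> n = 0")
    case True
    then show ?thesis using 1(2) nat_tree.simps[of m] nat_tree.simps[of n] by (auto split: if_splits)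
  next
    case False
    then have "odd m = odd n" "nat_tree (m div 2) = nat_tree (n div 2)"
      using 1(2) nat_tree.simps[of m] nat_tree.simps[of n] by auto
    then have "m mod 2 = n mod 2" "m div 2 = n div 2"
      using 1(1) False by (auto simp: odd_iff_mod_2_eq_one)
    then show ?thesis by (metis div_mult_mod_eq)
  qed
qed

instantiation nat :: treelike
begin
definition "to_tree = nat_tree"
instance by standard (auto simp: to_tree_nat_def dest: nat_tree_inj)
end

text \<open>A pair has the shape of a two-element list. With this choice the opening bracket of each
  component in the tape encoding is the \<open>Op\<close> of the cons cell that holds it, and the
  closing bracket of the pair is the final \<open>TNil\<close>.\<close>

instantiation prod :: (treelike, treelike) treelike
begin
definition "to_tree x = TCons (to_tree (fst x)) (TCons (to_tree (snd x)) TNil)"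
instance by standard (auto simp: to_tree_prod_def prod_eq_iff dest: to_tree_inj)
end

instantiation list :: (treelike) treelike
begin
definition "to_tree xs = foldr (\<lambda>x t. TCons (to_tree x) t) xs TNil"
instance
proof
  fix xs ys :: "'a list"
  show "to_tree xs = to_tree ys \<Longrightarrow> xs = ys"
  proof (induction xs arbitrary: ys)
    case Nil
    then show ?case by (cases ys) (auto simp: to_tree_list_def)
  next
    case (Cons x xs)
    then show ?case by (cases ys) (auto simp: to_tree_list_def dest: to_tree_inj)
  qed
qed
end

instantiation pv_inst :: treelike
begin
definition "to_tree I = TCons (to_tree (acts I)) (TCons (to_tree (tasks I)) (TCons (to_tree (ord I))
   (TCons (to_tree (lab I)) (TCons (to_tree (init I)) (TCons (to_tree (plan I)) TNil)))))"
instance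
  by standard (auto simp: to_tree_pv_inst_def intro!: pv_inst.expand dest!: to_tree_inj)
end

definition cd :: "'a::treelike \<Rightarrow> sym list" where
  "cd x = code (to_tree x)"

definition sz :: "'a::treelike \<Rightarrow> nat" where
  "sz x = length (cd x)"

lemma length_cd [simp]: "length (code (to_tree x)) = sz x"
  by (simp add: sz_def cd_def)

lemma cd_simps:
  "cd True = [Bit False, Cl]" "cd False = [Cl]"
  "cd (a, b) = Op # cd a @ Op # cd b @ [Cl]"
  "cd [] = [Cl]" "cd (x # xs) = Op # cd x @ cd xs"
  by (simp_all add: cd_def to_tree_bool_def to_tree_prod_def to_tree_list_def)

lemma sz_simps [simp]:
  "sz (a, b) = sz a + sz b + 3" "sz [] = 1" "sz (x # xs) = sz x + sz xs + 1"
  by (simp_all add: sz_def cd_simps)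

lemma cd_inj: "cd x = cd y \<longleftrightarrow> x = y"
  using to_tree_inj code_inj by (auto simp: cd_def)

abbreviation mstk :: "sym list \<Rightarrow> stacks" where
  "mstk u \<equiv> stk u [] [] []"

lemma runs_drop: "runs dropc (mstk (cd x @ u)) (20 * sz x + 20) (mstk u)"
  using runs_dropc[of "to_tree x" u] by (simp add: cd_def)

lemma runs_swap:
  "runs swapc (mstk (cd x @ cd y @ u)) (20 * sz x + 20 * sz y + 20) (mstk (cd y @ cd x @ u))"
  using runs_swapc[of "to_tree x" "to_tree y" u] by (simp add: cd_def)

lemma runs_dup: "runs dupc (mstk (cd x @ u)) (30 * sz x + 30) (mstk (cd x @ cd x @ u))"
  using runs_dupc[of "to_tree x" u] by (simp add: cd_def)

lemma runs_push_sym: "runs (Push RA (\<lambda>_. Some a)) (mstk u) 1 (mstk (a # u))"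
  by (rule runs_Push) simp

lemma runs_pop_sym: "runs (Pop RA) (mstk (a # u)) 1 (mstk u)"
  by (rule runs_Pop) simp

definition eqc :: com where
  "eqc = split RB ;; split RC ;; strip_loop ;;
     Cond (\<lambda>f. f RB = None \<and> f RC = None)
       (Push RA (\<lambda>_. Some Cl) ;; Push RA (\<lambda>_. Some (Bit False)))
       (clear RB ;; clear RC ;; Push RA (\<lambda>_. Some Cl))"

lemma runs_eqc:
  "runs eqc (mstk (cd x @ cd y @ u)) (30 * sz x + 30 * sz y + 30) (mstk (cd (x = y) @ u))"
proof -
  let ?x = "rev (cd x)" and ?y = "rev (cd y)"
  obtain b c where bc: "runs strip_loop (stk u ?x ?y []) (4 * length ?x + 1) (stk u b c [])"
    "b = [] \<and> c = [] \<longleftrightarrow> ?x = ?y" "length b \<le> length ?x" "length c \<le> length ?y"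
    using runs_strip_loop by blast
  have split1: "runs (split RB) (mstk (cd x @ cd y @ u)) (10 * sz x + 3) (stk (cd y @ u) ?x [] [])"
    using runs_split_RB[of "to_tree x" "cd y @ u" "[]" "[]"] by (simp add: cd_def)
  have split2: "runs (split RC) (stk (cd y @ u) ?x [] []) (10 * sz y + 3) (stk u ?x ?y [])"
    using runs_split_RC[of "to_tree y" u ?x "[]"] by (simp add: cd_def)
  let ?c = "Cond (\<lambda>f. f RB = None \<and> f RC = None)
       (Push RA (\<lambda>_. Some Cl) ;; Push RA (\<lambda>_. Some (Bit False)))
       (clear RB ;; clear RC ;; Push RA (\<lambda>_. Some Cl))"
  have "runs ?c (stk u b c []) (2 * sz x + 2 * sz y + 6) (mstk (cd (x = y) @ u))"
  proof (cases "x = y")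
    case True
    then have "b = []" "c = []" using bc(2) by auto
    then have "runs ?c (stk u b c []) (Suc (Suc (1 + 1))) (mstk (cd (x = y) @ u))"
      by (intro runs_Cond) (use True in \<open>simp add: tops_apply cd_simps
        runs_Seq[OF runs_push_sym runs_push_sym, simplified]\<close>)
    then show ?thesis by (rule runs_mono) simp
  next
    case False
    then have "\<not> (b = [] \<and> c = [])" using bc(2) by (simp add: cd_inj)
    moreover have "runs (clear RB ;; clear RC ;; Push RA (\<lambda>_. Some Cl)) (stk u b c [])
        (Suc ((2 * length b + 1) + Suc ((2 * length c + 1) + 1))) (mstk (cd (x = y) @ u))"
      using runs_clear[of RB "stk u b c []"] runs_clear[of RC "stk u [] c []"]
        runs_push_sym[of Cl u] False
      by (intro runs_Seq) (simp_all add: cd_simps)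
    ultimately have "runs ?c (stk u b c []) (Suc (Suc ((2 * length b + 1) + Suc ((2 * length c + 1) + 1))))
        (mstk (cd (x = y) @ u))"
      by (intro runs_Cond) (auto simp: tops_apply split: list.splits)
    then show ?thesis by (rule runs_mono) (use bc(3,4) in \<open>simp add: sz_def\<close>)
  qed
  with split1 split2 bc(1) have "runs eqc (mstk (cd x @ cd y @ u))
    (Suc ((10 * sz x + 3) + Suc ((10 * sz y + 3) + Suc ((4 * length ?x + 1) + (2 * sz x + 2 * sz y + 6)))))
    (mstk (cd (x = y) @ u))"
    unfolding eqc_def by (intro runs_Seq)
  then show ?thesis by (rule runs_mono) (simp add: sz_def)
qed

section \<open>Polynomial-time functions on encoded data\<close>

text \<open>The base is at least 2 even for \<open>n = 0\<close>, so constant factors and sums are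
  absorbed by a larger exponent and a single number describes the bound, which is moreover monotone
  in \<open>n\<close>.\<close>

definition pbd :: "(nat \<Rightarrow> nat) \<Rightarrow> bool" where
  "pbd f \<longleftrightarrow> (\<exists>k. \<forall>n. f n \<le> (n + 2) ^ k)"

named_theorems pbd_intros

lemma pbd_const [pbd_intros]: "pbd (\<lambda>_. c)"
proof -
  have "c \<le> (n + 2) ^ c" for n :: nat
    using less_exp[of c] power_mono[of 2 "n + 2" c] by linarith
  then show ?thesis unfolding pbd_def by blast
qed

lemma pbd_id [pbd_intros]: "pbd (\<lambda>n. n)"
  unfolding pbd_def by (intro exI[of _ 1]) simp

lemma pbd_mult [pbd_intros]: "pbd f \<Longrightarrow> pbd g \<Longrightarrow> pbd (\<lambda>n. f n * g n)"
  unfolding pbd_def by (metis mult_le_mono power_add)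

lemma pbd_add [pbd_intros]:
  assumes "pbd f" "pbd g"
  shows "pbd (\<lambda>n. f n + g n)"
proof -
  obtain j k where jk: "\<And>n. f n \<le> (n + 2) ^ j" "\<And>n. g n \<le> (n + 2) ^ k"
    using assms unfolding pbd_def by blast
  have "f n + g n \<le> (n + 2) ^ (j + k + 1)" for n
  proof -
    have "(n + 2) ^ j \<le> (n + 2) ^ (j + k)" "(n + 2) ^ k \<le> (n + 2) ^ (j + k)"
      by (intro power_increasing; simp)+
    then have "f n + g n \<le> 2 * (n + 2) ^ (j + k)" using jk[of n] by linarith
    also have "\<dots> \<le> (n + 2) ^ (j + k + 1)" by simp
    finally show ?thesis .
  qed
  then show ?thesis unfolding pbd_def by blast
qed

lemma pbd_Suc [pbd_intros]: "pbd f \<Longrightarrow> pbd (\<lambda>n. Suc (f n))"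
  using pbd_add[OF _ pbd_const[of 1]] by simp

lemma pbd_power [pbd_intros]: "pbd f \<Longrightarrow> pbd (\<lambda>n. f n ^ m)"
  unfolding pbd_def by (metis power_mono power_mult zero_le)

text \<open>The arbitrary \<open>u\<close> lets a program run above results that were computed
  earlier; \<open>ptime_binary\<close> and \<open>ptime_while\<close> depend on it.\<close>

definition ptime :: "'a::treelike set \<Rightarrow> ('a \<Rightarrow> 'b::treelike) \<Rightarrow> bool" where
  "ptime D f \<longleftrightarrow> (\<exists>p k. \<forall>x\<in>D. \<forall>u. runs p (mstk (cd x @ u)) ((sz x + 2) ^ k) (mstk (cd (f x) @ u)))"

named_theorems ptime_intros

lemma ptimeI:
  assumes "pbd b" "\<And>x u. x \<in> D \<Longrightarrow> runs p (mstk (cd x @ u)) (b (sz x)) (mstk (cd (f x) @ u))"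
  shows "ptime D f"
proof -
  obtain k where "\<And>n. b n \<le> (n + 2) ^ k" using assms(1) by (auto simp: pbd_def)
  then show ?thesis unfolding ptime_def using assms(2) by (meson runs_mono)
qed

text \<open>Results are no longer than argument plus time, so a time bound yields the size bound
  that the next program in a composition needs.\<close>

lemma runs_cd_sz:
  "runs p (mstk (cd x @ u)) T (mstk (cd y @ u)) \<Longrightarrow> sz y \<le> sz x + T"
  using runs_length[of p _ T _ RA] by (fastforce simp: sz_def)

lemma ptimeE:
  assumes "ptime D f"
  obtains p k where
    "\<And>x u. x \<in> D \<Longrightarrow> runs p (mstk (cd x @ u)) ((sz x + 2) ^ k) (mstk (cd (f x) @ u))"
    "\<And>x. x \<in> D \<Longrightarrow> sz (f x) \<le> sz x + (sz x + 2) ^ k"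
  using assms unfolding ptime_def by (meson runs_cd_sz)

lemma ptime_size:
  assumes "ptime D f"
  obtains k where "\<And>x. x \<in> D \<Longrightarrow> sz (f x) \<le> (sz x + 2) ^ k"
proof -
  obtain j where j: "\<And>x. x \<in> D \<Longrightarrow> sz (f x) \<le> sz x + (sz x + 2) ^ j"
    using ptimeE[OF assms] by metis
  have "pbd (\<lambda>n. n + (n + 2) ^ j)" by (intro pbd_intros)
  then obtain k where "\<And>n::nat. n + (n + 2) ^ j \<le> (n + 2) ^ k" unfolding pbd_def by blast
  then show ?thesis using j that by (meson order_trans)
qed

lemma ptime_subset: "ptime E f \<Longrightarrow> D \<subseteq> E \<Longrightarrow> ptime D f"
  unfolding ptime_def by blast

lemma ptime_id [ptime_intros]: "ptime D (\<lambda>x. x)"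
  by (rule ptimeI[OF pbd_const runs_Skip])

lemma ptime_comp:
  assumes "ptime D f" "ptime E g" "\<And>x. x \<in> D \<Longrightarrow> f x \<in> E"
  shows "ptime D (\<lambda>x. g (f x))"
proof -
  obtain p j where p: "\<And>x u. x \<in> D \<Longrightarrow> runs p (mstk (cd x @ u)) ((sz x + 2) ^ j) (mstk (cd (f x) @ u))"
    "\<And>x. x \<in> D \<Longrightarrow> sz (f x) \<le> sz x + (sz x + 2) ^ j"
    using ptimeE[OF assms(1)] by metis
  obtain q k where q: "\<And>x u. x \<in> E \<Longrightarrow> runs q (mstk (cd x @ u)) ((sz x + 2) ^ k) (mstk (cd (g x) @ u))"
    using ptimeE[OF assms(2)] by metis
  have "runs (p ;; q) (mstk (cd x @ u)) (Suc ((sz x + 2) ^ j + (sz x + (sz x + 2) ^ j + 2) ^ k))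
     (mstk (cd (g (f x)) @ u))" if "x \<in> D" for x u
    using runs_Seq[OF p(1)[OF that] q[OF assms(3)[OF that]], of u] p(2)[OF that]
    by (elim runs_mono) (intro Suc_le_mono[THEN iffD2] add_left_mono power_mono; simp)
  then show ?thesis
    by (intro ptimeI[of "\<lambda>n. Suc ((n + 2) ^ j + (n + (n + 2) ^ j + 2) ^ k)"] pbd_intros)
qed

lemma ptime_comp_UNIV: "ptime UNIV g \<Longrightarrow> ptime D f \<Longrightarrow> ptime D (\<lambda>x. g (f x))"
  by (rule ptime_comp) auto

text \<open>The argument is duplicated, \<open>g\<close> consumes one copy, a swap brings the other
  copy to the top for \<open>f\<close>, and \<open>q\<close> finds both results in the right
  order.\<close>

lemma ptime_binary:
  assumes "ptime D f" "ptime D g"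
    and h: "\<And>a b u. runs q (mstk (cd a @ cd b @ u)) (c * (sz a + sz b + 1)) (mstk (cd (h a b) @ u))"
  shows "ptime D (\<lambda>x. h (f x) (g x))"
proof -
  obtain pf j where pf: "\<And>x u. x \<in> D \<Longrightarrow> runs pf (mstk (cd x @ u)) ((sz x + 2) ^ j) (mstk (cd (f x) @ u))"
    "\<And>x. x \<in> D \<Longrightarrow> sz (f x) \<le> sz x + (sz x + 2) ^ j"
    using ptimeE[OF assms(1)] by metis
  obtain pg k where pg: "\<And>x u. x \<in> D \<Longrightarrow> runs pg (mstk (cd x @ u)) ((sz x + 2) ^ k) (mstk (cd (g x) @ u))"
    "\<And>x. x \<in> D \<Longrightarrow> sz (g x) \<le> sz x + (sz x + 2) ^ k"
    using ptimeE[OF assms(2)] by metis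
  define b where "b n = Suc ((30 * n + 30) + Suc ((n + 2) ^ k +
     Suc ((20 * (n + (n + 2) ^ k) + 20 * n + 20) + Suc ((n + 2) ^ j +
       c * ((n + (n + 2) ^ j) + (n + (n + 2) ^ k) + 1)))))" for n
  have "runs (dupc ;; pg ;; swapc ;; pf ;; q) (mstk (cd x @ u)) (b (sz x)) (mstk (cd (h (f x) (g x)) @ u))"
    if x: "x \<in> D" for x u
  proof -
    have "runs (dupc ;; pg ;; swapc ;; pf ;; q) (mstk (cd x @ u))
      (Suc ((30 * sz x + 30) + Suc ((sz x + 2) ^ k + Suc ((20 * sz (g x) + 20 * sz x + 20) +
        Suc ((sz x + 2) ^ j + c * (sz (f x) + sz (g x) + 1))))))
      (mstk (cd (h (f x) (g x)) @ u))"
      by (intro runs_Seq) (rule runs_dup pg(1)[OF x] runs_swap pf(1)[OF x] h)+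
    then show ?thesis
    proof (rule runs_mono)
      have "c * (sz (f x) + sz (g x) + 1) \<le> c * ((sz x + (sz x + 2) ^ j) + (sz x + (sz x + 2) ^ k) + 1)"
        using pf(2)[OF x] pg(2)[OF x] by (intro mult_le_mono) auto
      then show "Suc ((30 * sz x + 30) + Suc ((sz x + 2) ^ k + Suc ((20 * sz (g x) + 20 * sz x + 20) +
        Suc ((sz x + 2) ^ j + c * (sz (f x) + sz (g x) + 1))))) \<le> b (sz x)"
        unfolding b_def
        by (intro Suc_le_mono[THEN iffD2] add_mono le_refl) (use pg(2)[OF x] in auto)
    qed
  qed
  moreover have "pbd b" unfolding b_def[abs_def] by (intro pbd_intros)
  ultimately show ?thesis by (intro ptimeI[of b])
qed

lemma ptime_Pair [ptime_intros]:
  assumes "ptime D f" "ptime D g"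
  shows "ptime D (\<lambda>x. (f x, g x))"
proof (rule ptime_binary[OF assms, where h = Pair and c = 200])
  fix a :: 'b and b :: 'c and u
  let ?a = "to_tree a" and ?b = "to_tree b"
  let ?q = "swapc ;; Push RA (\<lambda>_. Some Cl) ;; swapc ;; Push RA (\<lambda>_. Some Op) ;; swapc ;; Push RA (\<lambda>_. Some Op)"
  have "runs swapc (mstk (code ?a @ code ?b @ u)) (20 * sz a + 20 * sz b + 20) (mstk (code ?b @ code ?a @ u))"
    using runs_swapc[of ?a ?b u] by simp
  moreover have "runs (Push RA (\<lambda>_. Some Cl)) (mstk (code ?b @ code ?a @ u)) 1
      (mstk (code TNil @ code ?b @ code ?a @ u))"
    using runs_push_sym by simp
  moreover have "runs swapc (mstk (code TNil @ code ?b @ code ?a @ u)) (20 * sz b + 40)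
      (mstk (code ?b @ code TNil @ code ?a @ u))"
    using runs_swapc[of TNil ?b "code ?a @ u"] by (simp add: algebra_simps)
  moreover have "runs (Push RA (\<lambda>_. Some Op)) (mstk (code ?b @ code TNil @ code ?a @ u)) 1
      (mstk (code (TCons ?b TNil) @ code ?a @ u))"
    using runs_push_sym by simp
  moreover have "runs swapc (mstk (code (TCons ?b TNil) @ code ?a @ u)) (20 * sz b + 20 * sz a + 60)
      (mstk (code ?a @ code (TCons ?b TNil) @ u))"
    using runs_swapc[of "TCons ?b TNil" ?a u] by (simp add: algebra_simps)
  moreover have "runs (Push RA (\<lambda>_. Some Op)) (mstk (code ?a @ code (TCons ?b TNil) @ u)) 1
      (mstk (cd (a, b) @ u))"
    using runs_push_sym[of Op] by (simp add: cd_def to_tree_prod_def)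
  ultimately have "runs ?q (mstk (code ?a @ code ?b @ u))
     (Suc ((20 * sz a + 20 * sz b + 20) + Suc (1 + Suc ((20 * sz b + 40) + Suc (1 +
       Suc ((20 * sz b + 20 * sz a + 60) + 1)))))) (mstk (cd (a, b) @ u))"
    by (intro runs_Seq)
  then show "runs ?q (mstk (cd a @ cd b @ u)) (200 * (sz a + sz b + 1)) (mstk (cd (a, b) @ u))"
    unfolding cd_def by (rule runs_mono) simp
qed

section \<open>Projections, constructors and case distinction\<close>

definition leftc :: com where "leftc = Pop RA ;; swapc ;; dropc"
definition rightc :: com where "rightc = Pop RA ;; dropc"

lemma runs_leftc:
  "runs leftc (mstk (code (TCons t v) @ u)) (60 * length (code (TCons t v))) (mstk (code t @ u))"
proof -
  have "runs leftc (mstk (code (TCons t v) @ u))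
      (Suc (1 + Suc ((20 * length (code t) + 20 * length (code v) + 20) + (20 * length (code v) + 20))))
      (mstk (code t @ u))"
    unfolding leftc_def
    using runs_Seq[OF runs_pop_sym[of Op] runs_Seq[OF runs_swapc[of t v u] runs_dropc[of v "code t @ u"]]]
    by simp
  then show ?thesis by (rule runs_mono) simp
qed

lemma runs_rightc:
  "runs rightc (mstk (code (TCons t v) @ u)) (60 * length (code (TCons t v))) (mstk (code v @ u))"
proof -
  have "runs rightc (mstk (code (TCons t v) @ u))
      (Suc (1 + (20 * length (code t) + 20))) (mstk (code v @ u))"
    unfolding rightc_def
    using runs_Seq[OF runs_pop_sym[of Op] runs_dropc[of t "code v @ u"]] by simp
  then show ?thesis by (rule runs_mono) simp
qed

fun selc :: "nat \<Rightarrow> com" where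
  "selc 0 = leftc"
| "selc (Suc n) = rightc ;; selc n"

fun sel :: "nat \<Rightarrow> tree \<Rightarrow> tree option" where
  "sel 0 (TCons t u) = Some t"
| "sel (Suc n) (TCons t u) = sel n u"
| "sel _ _ = None"

lemma runs_selc:
  "sel n t = Some v \<Longrightarrow> runs (selc n) (mstk (code t @ u)) (Suc n * (60 * length (code t) + 1)) (mstk (code v @ u))"
proof (induction n t rule: sel.induct)
  case (1 t w)
  then show ?case using runs_mono[OF runs_leftc[of t w u]] by simp
next
  case (2 n t w)
  have "runs (selc (Suc n)) (mstk (code (TCons t w) @ u))
      (Suc (60 * length (code (TCons t w)) + Suc n * (60 * length (code w) + 1))) (mstk (code v @ u))"
    unfolding selc.simps by (intro runs_Seq[OF runs_rightc] 2(1)) (use 2(2) in simp)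
  then show ?case
  proof (rule runs_mono)
    have "Suc n * (60 * length (code w) + 1) \<le> Suc n * (60 * length (code (TCons t w)) + 1)"
      by (intro mult_le_mono) auto
    then show "Suc (60 * length (code (TCons t w)) + Suc n * (60 * length (code w) + 1))
        \<le> Suc (Suc n) * (60 * length (code (TCons t w)) + 1)"
      by simp
  qed
qed auto

lemma ptime_sel:
  assumes "\<And>x. x \<in> E \<Longrightarrow> sel n (to_tree x) = Some (to_tree (g x))"
    and "ptime D f" "\<And>x. x \<in> D \<Longrightarrow> f x \<in> E"
  shows "ptime D (\<lambda>x. g (f x))"
proof (rule ptime_comp[OF assms(2) _ assms(3)])
  show "ptime E g"
  proof (rule ptimeI)
    show "runs (selc n) (mstk (cd x @ u)) (Suc n * (60 * sz x + 1)) (mstk (cd (g x) @ u))"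
      if "x \<in> E" for x u
      using runs_selc[OF assms(1)[OF that]] by (simp add: cd_def)
  qed (intro pbd_intros)
qed

lemma ptime_fst [ptime_intros]: "ptime D f \<Longrightarrow> ptime D (\<lambda>x. fst (f x))"
  by (rule ptime_sel[where E = UNIV and n = 0]) (auto simp: to_tree_prod_def)

lemma ptime_snd [ptime_intros]: "ptime D f \<Longrightarrow> ptime D (\<lambda>x. snd (f x))"
  by (rule ptime_sel[where E = UNIV and n = "Suc 0"]) (auto simp: to_tree_prod_def)

lemma ptime_acts [ptime_intros]: "ptime D f \<Longrightarrow> ptime D (\<lambda>x. acts (f x))"
  by (rule ptime_sel[where E = UNIV and n = 0]) (auto simp: to_tree_pv_inst_def)

lemma ptime_tasks [ptime_intros]: "ptime D f \<Longrightarrow> ptime D (\<lambda>x. tasks (f x))"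
  by (rule ptime_sel[where E = UNIV and n = "Suc 0"]) (auto simp: to_tree_pv_inst_def)

lemma ptime_ord [ptime_intros]: "ptime D f \<Longrightarrow> ptime D (\<lambda>x. ord (f x))"
  by (rule ptime_sel[where E = UNIV and n = "Suc (Suc 0)"]) (auto simp: to_tree_pv_inst_def)

lemma ptime_lab [ptime_intros]: "ptime D f \<Longrightarrow> ptime D (\<lambda>x. lab (f x))"
  by (rule ptime_sel[where E = UNIV and n = "Suc (Suc (Suc 0))"]) (auto simp: to_tree_pv_inst_def)

lemma ptime_init [ptime_intros]: "ptime D f \<Longrightarrow> ptime D (\<lambda>x. init (f x))"
  by (rule ptime_sel[where E = UNIV and n = "Suc (Suc (Suc (Suc 0)))"]) (auto simp: to_tree_pv_inst_def)

lemma ptime_plan [ptime_intros]: "ptime D f \<Longrightarrow> ptime D (\<lambda>x. plan (f x))"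
  by (rule ptime_sel[where E = UNIV and n = "Suc (Suc (Suc (Suc (Suc 0))))"]) (auto simp: to_tree_pv_inst_def)

lemma ptime_hd:
  assumes "ptime D f" "\<And>x. x \<in> D \<Longrightarrow> f x \<noteq> []"
  shows "ptime D (\<lambda>x. hd (f x))"
  by (rule ptime_sel[where E = "{xs. xs \<noteq> []}" and n = 0, OF _ assms(1)])
    (use assms(2) in \<open>auto simp: to_tree_list_def neq_Nil_conv\<close>)

lemma ptime_Cons [ptime_intros]:
  assumes "ptime D f" "ptime D g"
  shows "ptime D (\<lambda>x. f x # g x)"
proof (rule ptime_binary[OF assms, where h = Cons and c = 1])
  fix a :: 'b and b :: "'b list" and u
  show "runs (Push RA (\<lambda>_. Some Op)) (mstk (cd a @ cd b @ u)) (1 * (sz a + sz b + 1)) (mstk (cd (a # b) @ u))"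
    using runs_mono[OF runs_push_sym[of Op "cd a @ cd b @ u"]] by (simp add: cd_simps)
qed

lemma ptime_eq [ptime_intros]:
  assumes "ptime D f" "ptime D g"
  shows "ptime D (\<lambda>x. f x = g x)"
proof (rule ptime_binary[OF assms, where h = "(=)" and c = 30])
  fix a :: 'b and b :: "'b" and u
  show "runs eqc (mstk (cd a @ cd b @ u)) (30 * (sz a + sz b + 1)) (mstk (cd (a = b) @ u))"
    using runs_eqc[of a b u] by (simp add: algebra_simps)
qed

fun push_word :: "sym list \<Rightarrow> com" where
  "push_word [] = Skip"
| "push_word (a # w) = push_word w ;; Push RA (\<lambda>_. Some a)"

lemma runs_push_word: "runs (push_word w) (mstk u) (2 * length w + 1) (mstk (w @ u))"
proof (induction w)
  case Nil
  then show ?case using runs_Skip by simp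
next
  case (Cons a w)
  have "runs (push_word (a # w)) (mstk u) (Suc ((2 * length w + 1) + 1)) (mstk (a # w @ u))"
    using runs_Seq[OF Cons runs_push_sym[of a]] by simp
  then show ?case by simp
qed

lemma ptime_const [ptime_intros]: "ptime D (\<lambda>_. c)"
proof (rule ptimeI)
  show "runs (dropc ;; push_word (cd c)) (mstk (cd x @ u)) (Suc ((20 * sz x + 20) + (2 * sz c + 1)))
    (mstk (cd c @ u))" for x :: 'a and u
    using runs_Seq[OF runs_drop runs_push_word[of "cd c"], of x u] by (simp add: sz_def)
qed (intro pbd_intros)

lemma ptime_tl [ptime_intros]:
  assumes "ptime D f"
  shows "ptime D (\<lambda>x. tl (f x))"
proof (rule ptime_comp_UNIV[OF _ assms], rule ptimeI)
  fix xs :: "'b list" and u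
  show "runs (Cond (\<lambda>f. f RA = Some Op) (Pop RA ;; dropc) Skip) (mstk (cd xs @ u))
    (20 * sz xs + 30) (mstk (cd (tl xs) @ u))"
  proof (cases xs)
    case Nil
    have "runs (Cond (\<lambda>f. f RA = Some Op) (Pop RA ;; dropc) Skip) (mstk (cd xs @ u)) (Suc 1)
       (mstk (cd (tl xs) @ u))"
      by (rule runs_Cond) (use Nil runs_Skip in \<open>simp add: tops_apply cd_simps\<close>)
    then show ?thesis by (rule runs_mono) simp
  next
    case (Cons y ys)
    have "runs (Pop RA ;; dropc) (mstk (cd xs @ u)) (Suc (1 + (20 * sz y + 20))) (mstk (cd ys @ u))"
      using runs_Seq[OF runs_pop_sym[of Op] runs_drop[of y "cd ys @ u"]] Cons by (simp add: cd_simps)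
    then have "runs (Cond (\<lambda>f. f RA = Some Op) (Pop RA ;; dropc) Skip) (mstk (cd xs @ u))
       (Suc (Suc (1 + (20 * sz y + 20)))) (mstk (cd (tl xs) @ u))"
      by (intro runs_Cond) (use Cons in \<open>simp add: tops_apply cd_simps\<close>)
    then show ?thesis by (rule runs_mono) (simp add: Cons)
  qed
qed (intro pbd_intros)

lemma ptime_if [ptime_intros]:
  assumes b: "ptime D b" and f: "ptime {x \<in> D. b x} f" and g: "ptime {x \<in> D. \<not> b x} g"
  shows "ptime D (\<lambda>x. if b x then f x else g x)"
proof -
  obtain pb i where pb: "\<And>x u. x \<in> D \<Longrightarrow> runs pb (mstk (cd x @ u)) ((sz x + 2) ^ i) (mstk (cd (b x) @ u))"
    using ptimeE[OF b] by metis
  obtain pf j where pf: "\<And>x u. x \<in> {x \<in> D. b x} \<Longrightarrow>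
      runs pf (mstk (cd x @ u)) ((sz x + 2) ^ j) (mstk (cd (f x) @ u))"
    using ptimeE[OF f] by metis
  obtain pg k where pg: "\<And>x u. x \<in> {x \<in> D. \<not> b x} \<Longrightarrow>
      runs pg (mstk (cd x @ u)) ((sz x + 2) ^ k) (mstk (cd (g x) @ u))"
    using ptimeE[OF g] by metis
  \<comment> \<open>\<open>cd False\<close> is one symbol long and \<open>cd True\<close> two, so
    one or two pops remove the tested value and expose the saved argument.\<close>
  let ?c = "Cond (\<lambda>f. f RA = Some Cl) (Pop RA ;; pg) (Pop RA ;; Pop RA ;; pf)"
  let ?h = "\<lambda>x. if b x then f x else g x"
  have "runs (dupc ;; pb ;; ?c) (mstk (cd x @ u))
      (Suc ((30 * sz x + 30) + Suc ((sz x + 2) ^ i + ((sz x + 2) ^ j + (sz x + 2) ^ k + 5))))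
      (mstk (cd (?h x) @ u))" if "x \<in> D" for x u
  proof -
    have "runs ?c (mstk (cd (b x) @ cd x @ u)) ((sz x + 2) ^ j + (sz x + 2) ^ k + 5) (mstk (cd (?h x) @ u))"
    proof (cases "b x")
      case True
      have "runs (Pop RA ;; Pop RA ;; pf) (mstk (cd (b x) @ cd x @ u)) (Suc (1 + Suc (1 + (sz x + 2) ^ j)))
          (mstk (cd (?h x) @ u))"
        using runs_Seq[OF runs_pop_sym runs_Seq[OF runs_pop_sym pf]] that True by (simp add: cd_simps)
      then have "runs ?c (mstk (cd (b x) @ cd x @ u)) (Suc (Suc (1 + Suc (1 + (sz x + 2) ^ j))))
          (mstk (cd (?h x) @ u))"
        by (intro runs_Cond) (use True in \<open>simp add: tops_apply cd_simps\<close>)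
      then show ?thesis by (rule runs_mono) simp
    next
      case False
      have "runs (Pop RA ;; pg) (mstk (cd (b x) @ cd x @ u)) (Suc (1 + (sz x + 2) ^ k))
          (mstk (cd (?h x) @ u))"
        using runs_Seq[OF runs_pop_sym pg] that False by (simp add: cd_simps)
      then have "runs ?c (mstk (cd (b x) @ cd x @ u)) (Suc (Suc (1 + (sz x + 2) ^ k)))
          (mstk (cd (?h x) @ u))"
        by (intro runs_Cond) (use False in \<open>simp add: tops_apply cd_simps\<close>)
      then show ?thesis by (rule runs_mono) simp
    qed
    then show ?thesis by (intro runs_Seq[OF runs_dup] runs_Seq[OF pb[OF that]])
  qed
  then show ?thesis
    by (intro ptimeI[of "\<lambda>n. Suc ((30 * n + 30) + Suc ((n + 2) ^ i + ((n + 2) ^ j + (n + 2) ^ k + 5)))"]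
        pbd_intros)
qed

lemma ptime_not [ptime_intros]: "ptime D f \<Longrightarrow> ptime D (\<lambda>x. \<not> f x)"
  using ptime_eq[OF _ ptime_const[of D False]] by simp

lemma ptime_bool [ptime_intros]:
  assumes "ptime D f" "ptime D g"
  shows "ptime D (\<lambda>x. f x \<and> g x)" "ptime D (\<lambda>x. f x \<or> g x)" "ptime D (\<lambda>x. f x \<longrightarrow> g x)"
proof -
  have 1: "ptime D (\<lambda>x. if f x then g x else False)" "ptime D (\<lambda>x. if f x then True else g x)"
    "ptime D (\<lambda>x. if f x then g x else True)"
    by (intro ptime_if ptime_const assms ptime_subset[OF assms(2)] Collect_restrict)+
  have "(if f x then g x else False) = (f x \<and> g x)" "(if f x then True else g x) = (f x \<or> g x)"
    "(if f x then g x else True) = (f x \<longrightarrow> g x)" for x by auto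
  then show "ptime D (\<lambda>x. f x \<and> g x)" "ptime D (\<lambda>x. f x \<or> g x)" "ptime D (\<lambda>x. f x \<longrightarrow> g x)"
    using 1 by (simp_all only:)
qed

subsection \<open>Iteration\<close>

text \<open>The size of every intermediate state is bounded by hypothesis, since a step that merely
  doubles its argument would already exceed any polynomial after linearly many rounds. With this
  bound each round costs a fixed polynomial in the input size.\<close>

lemma ptime_while:
  assumes c: "ptime UNIV c" and g: "ptime E g"
    and iter: "\<And>y i. y \<in> D \<Longrightarrow> i < m y \<Longrightarrow> (g ^^ i) y \<in> E \<and> c ((g ^^ i) y)"
    and stop: "\<And>y. y \<in> D \<Longrightarrow> \<not> c ((g ^^ m y) y)"
    and size: "\<And>y i. y \<in> D \<Longrightarrow> i \<le> m y \<Longrightarrow> sz ((g ^^ i) y) \<le> N (sz y)"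
    and m: "\<And>y. y \<in> D \<Longrightarrow> m y \<le> sz y" and N: "pbd N"
  shows "ptime D (\<lambda>y. (g ^^ m y) y)"
proof -
  obtain pc i where pc: "\<And>y u. runs pc (mstk (cd y @ u)) ((sz y + 2) ^ i) (mstk (cd (c y) @ u))"
    using ptimeE[OF c] by (metis UNIV_I)
  obtain pg j where pg: "\<And>y u. y \<in> E \<Longrightarrow> runs pg (mstk (cd y @ u)) ((sz y + 2) ^ j) (mstk (cd (g y) @ u))"
    using ptimeE[OF g] by metis
  \<comment> \<open>At each test the truth value of \<open>c\<close> lies above the current state; a
    round drops it, applies \<open>g\<close>, and tests a copy of the new state.\<close>
  define W where "W = While (\<lambda>f. f RA \<noteq> Some Cl) (dropc ;; pg ;; dupc ;; pc)"
  \<comment> \<open>60 is the time for dropping \<open>cd True\<close>, and 5 covers the sequencing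
    and the loop test.\<close>
  define b where "b n = 60 + ((n + 2) ^ j + ((30 * n + 30) + (n + 2) ^ i)) + 5" for n :: nat
  have loop: "runs W (mstk (cd (c y) @ cd y @ u)) (l * b n + 1) (mstk (cd False @ cd ((g ^^ l) y) @ u))"
    if "\<And>i. i < l \<Longrightarrow> (g ^^ i) y \<in> E \<and> c ((g ^^ i) y)" "\<not> c ((g ^^ l) y)"
      "\<And>i. i \<le> l \<Longrightarrow> sz ((g ^^ i) y) \<le> n" for y l n u
    using that
  proof (induction l arbitrary: y)
    case 0
    then have "runs W (mstk (cd False @ cd y @ u)) 1 (mstk (cd False @ cd y @ u))"
      unfolding W_def by (intro runs_WhileF) (simp add: tops_apply cd_simps)
    then show ?case using 0 by simp
  next
    case (Suc l)
    have y: "y \<in> E" "c y" using Suc.prems(1)[of 0] by auto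
    have sy: "sz y \<le> n" "sz (g y) \<le> n" using Suc.prems(3)[of 0] Suc.prems(3)[of 1] by auto
    have "runs dropc (mstk (cd True @ cd y @ u)) 60 (mstk (cd y @ u))"
      using runs_drop[of True "cd y @ u"] by (simp add: sz_def cd_simps)
    then have "runs (dropc ;; pg ;; dupc ;; pc) (mstk (cd True @ cd y @ u))
       (Suc (60 + Suc ((sz y + 2) ^ j + Suc ((30 * sz (g y) + 30) + (sz (g y) + 2) ^ i))))
       (mstk (cd (c (g y)) @ cd (g y) @ u))"
      by (intro runs_Seq) (rule pg[OF y(1)] runs_dup pc | assumption)+
    moreover have "(sz y + 2) ^ j \<le> (n + 2) ^ j" "(sz (g y) + 2) ^ i \<le> (n + 2) ^ i"
      using sy by (auto intro: power_mono)
    ultimately have body: "runs (dropc ;; pg ;; dupc ;; pc) (mstk (cd True @ cd y @ u)) (b n - 1)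
       (mstk (cd (c (g y)) @ cd (g y) @ u))"
      using sy by (elim runs_mono) (simp add: b_def)
    have "runs W (mstk (cd (c (g y)) @ cd (g y) @ u)) (l * b n + 1) (mstk (cd False @ cd ((g ^^ l) (g y)) @ u))"
    proof (rule Suc.IH)
      show "(g ^^ i) (g y) \<in> E \<and> c ((g ^^ i) (g y))" if "i < l" for i
        using Suc.prems(1)[of "Suc i"] that by (simp add: funpow_swap1)
      show "\<not> c ((g ^^ l) (g y))" using Suc.prems(2) by (simp add: funpow_swap1)
      show "sz ((g ^^ i) (g y)) \<le> n" if "i \<le> l" for i
        using Suc.prems(3)[of "Suc i"] that by (simp add: funpow_swap1)
    qed
    then have "runs W (mstk (cd True @ cd y @ u)) (Suc ((b n - 1) + (l * b n + 1)))
        (mstk (cd False @ cd ((g ^^ l) (g y)) @ u))"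
      using body unfolding W_def by (intro runs_WhileT) (auto simp: tops_apply cd_simps)
    moreover have "Suc ((b n - 1) + (l * b n + 1)) = Suc l * b n + 1" by (simp add: b_def)
    ultimately show ?case using y(2) by (simp add: funpow_swap1)
  qed
  define B where "B n = Suc ((30 * n + 30) + Suc ((n + 2) ^ i + Suc ((n * b (N n) + 1) + 40)))" for n :: nat
  have "runs (dupc ;; pc ;; W ;; dropc) (mstk (cd y @ u)) (B (sz y)) (mstk (cd ((g ^^ m y) y) @ u))"
    if y: "y \<in> D" for y u
  proof -
    have "runs W (mstk (cd (c y) @ cd y @ u)) (m y * b (N (sz y)) + 1)
        (mstk (cd False @ cd ((g ^^ m y) y) @ u))"
      using iter stop size y by (intro loop) auto
    then have "runs W (mstk (cd (c y) @ cd y @ u)) (sz y * b (N (sz y)) + 1)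
        (mstk (cd False @ cd ((g ^^ m y) y) @ u))"
      by (rule runs_mono) (use m[OF y] in simp)
    moreover have "runs dropc (mstk (cd False @ cd ((g ^^ m y) y) @ u)) 40 (mstk (cd ((g ^^ m y) y) @ u))"
      using runs_drop[of False "cd ((g ^^ m y) y) @ u"] by (simp add: sz_def cd_simps)
    ultimately show ?thesis unfolding B_def
      by (intro runs_Seq) (rule runs_dup pc | assumption)+
  qed
  moreover have "pbd B" unfolding B_def[abs_def] b_def using N by (intro pbd_intros)
  ultimately show ?thesis by (intro ptimeI[of B])
qed

lemma length_le_sz: "length xs \<le> sz xs"
  by (induction xs) auto

lemma sz_mem: "a \<in> set xs \<Longrightarrow> sz a \<le> sz xs"
  by (induction xs) auto

lemma sz_append: "Suc (sz (xs @ ys)) = sz xs + sz ys"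
  by (induction xs) auto

lemma sz_drop: "sz (drop i xs) \<le> sz xs"
proof (induction xs arbitrary: i)
  case (Cons x xs)
  then show ?case by (cases i) (auto intro: le_SucI trans_le_add2)
qed simp

text \<open>The loop state carries \<open>x\<close> next to the remaining list and the accumulator,
  because the step may consult it. Prefixes of \<open>l x\<close> give exactly the accumulators that
  occur.\<close>

lemma ptime_fold:
  fixes st :: "'a::treelike \<Rightarrow> 'c::treelike \<Rightarrow> 'b::treelike \<Rightarrow> 'b"
  assumes l: "ptime D l" and i: "ptime D i"
    and st: "ptime UNIV (\<lambda>z. st (fst z) (fst (snd z)) (snd (snd z)))"
    and N: "pbd N"
    and bound: "\<And>x us vs. x \<in> D \<Longrightarrow> l x = us @ vs \<Longrightarrow> sz (fold (st x) us (i x)) \<le> N (sz x)"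
  shows "ptime D (\<lambda>x. fold (st x) (l x) (i x))"
proof -
  define ini where "ini x = (l x, (i x, x))" for x
  define g where "g y = (tl (fst y), (st (snd (snd y)) (hd (fst y)) (fst (snd y)), snd (snd y)))"
    for y :: "'c list \<times> 'b \<times> 'a"
  have st': "ptime E (\<lambda>y. st (f1 y) (f2 y) (f3 y))"
    if "ptime E f1" "ptime E f2" "ptime E f3" for E :: "('c list \<times> 'b \<times> 'a) set" and f1 f2 f3
    using ptime_comp_UNIV[OF st ptime_Pair[OF that(1) ptime_Pair[OF that(2,3)]]] by simp
  have iter: "(g ^^ j) (xs, (acc, x)) = (drop j xs, (fold (st x) (take j xs) acc, x))"
    if "j \<le> length xs" for j xs acc x
    using that
  proof (induction j)
    case (Suc j)
    then show ?case by (simp add: g_def hd_drop_conv_nth take_Suc_conv_app_nth tl_drop drop_Suc)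
  qed simp
  \<comment> \<open>A monotone majorant of \<open>N\<close> is needed because the bound refers to
    \<open>sz x\<close>, whereas the loop rule measures the larger initial state
    \<open>y\<close>.\<close>
  obtain K where K: "pbd K" "\<And>n m. n \<le> m \<Longrightarrow> K n \<le> K m" "\<And>n. N n \<le> K n"
  proof -
    obtain k where "\<And>n. N n \<le> (n + 2) ^ k" using N by (auto simp: pbd_def)
    then show ?thesis
      by (intro that[of "\<lambda>n. (n + 2) ^ k"] pbd_intros) (auto intro: power_mono)
  qed
  have "ptime (ini ` D) (\<lambda>y. (g ^^ length (fst y)) y)"
  \<comment> \<open>The outer two terms bound the remaining list and \<open>x\<close>; 6 pays for
    the two nested pairs.\<close>
  proof (rule ptime_while[where c = "\<lambda>y. fst y \<noteq> []" and E = "{y. fst y \<noteq> []}"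
        and N = "\<lambda>n. n + K n + n + 6"])
    show "ptime UNIV (\<lambda>y. fst y \<noteq> [])"
      by (intro ptime_intros)
    show "ptime {y. fst y \<noteq> []} g"
      unfolding g_def by (intro ptime_intros st' ptime_hd) auto
    show "pbd (\<lambda>n. n + K n + n + 6)"
      using K(1) by (intro pbd_intros)
  next
    fix y j assume "y \<in> ini ` D" "j < length (fst y)"
    then show "(g ^^ j) y \<in> {y. fst y \<noteq> []} \<and> fst ((g ^^ j) y) \<noteq> []"
      by (auto simp: ini_def iter)
  next
    fix y assume "y \<in> ini ` D"
    then show "\<not> fst ((g ^^ length (fst y)) y) \<noteq> []"
      by (auto simp: ini_def iter)
  next
    fix y j assume "y \<in> ini ` D" and j: "j \<le> length (fst y)"
    then obtain x where x: "x \<in> D" "y = ini x" by blast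
    have "sz (fold (st x) (take j (l x)) (i x)) \<le> N (sz x)"
      using bound[OF x(1), of "take j (l x)" "drop j (l x)"] by simp
    also have "\<dots> \<le> K (sz y)" using K(2)[of "sz x" "sz y"] K(3)[of "sz x"] x(2)
      by (simp add: ini_def)
    finally show "sz ((g ^^ j) y) \<le> sz y + K (sz y) + sz y + 6"
      using j x sz_drop[of j "l x"] by (simp add: ini_def iter)
  next
    fix y assume "y \<in> ini ` D"
    then obtain x where "y = ini x" by blast
    then show "length (fst y) \<le> sz y"
      using length_le_sz[of "l x"] by (simp add: ini_def)
  qed
  moreover have "ptime D ini" unfolding ini_def using l i by (intro ptime_intros)
  ultimately have "ptime D (\<lambda>x. (g ^^ length (fst (ini x))) (ini x))"
    by (intro ptime_comp[where f = ini and g = "\<lambda>y. (g ^^ length (fst y)) y" and E = "ini ` D"]) auto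
  then have "ptime D (\<lambda>x. fst (snd ((g ^^ length (fst (ini x))) (ini x))))"
    by (intro ptime_intros)
  then show ?thesis by (simp add: ini_def iter)
qed

text \<open>An increment that depends on \<open>x\<close> and \<open>a\<close> but not on the
  accumulator adds up instead of compounding, which supplies the size bound of
  \<open>ptime_fold\<close>. The list operations are of this kind; the search below is not.\<close>

lemma ptime_fold_additive:
  fixes st :: "'a::treelike \<Rightarrow> 'c::treelike \<Rightarrow> 'b::treelike \<Rightarrow> 'b"
  assumes l: "ptime D l" and i: "ptime D i"
    and st: "ptime UNIV (\<lambda>z. st (fst z) (fst (snd z)) (snd (snd z)))"
    and add: "\<And>x a acc. sz (st x a acc) \<le> sz acc + (sz x + sz a + 5) ^ k"
  shows "ptime D (\<lambda>x. fold (st x) (l x) (i x))"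
proof -
  obtain kl where kl: "\<And>x. x \<in> D \<Longrightarrow> sz (l x) \<le> (sz x + 2) ^ kl" using ptime_size[OF l] by metis
  obtain ki where ki: "\<And>x. x \<in> D \<Longrightarrow> sz (i x) \<le> (sz x + 2) ^ ki" using ptime_size[OF i] by metis
  show ?thesis
  proof (rule ptime_fold[OF l i st])
    show "pbd (\<lambda>n. (n + 2) ^ ki + (n + 2) ^ kl * (n + (n + 2) ^ kl + 5) ^ k)"
      by (intro pbd_intros)
    fix x us vs assume x: "x \<in> D" and eq: "l x = us @ vs"
    let ?B = "(sz x + (sz x + 2) ^ kl + 5) ^ k"
    have "sz (fold (st x) us acc) \<le> sz acc + length us * ?B" if "set us \<subseteq> set (l x)" for us acc
      using that
    proof (induction us arbitrary: acc)
      case (Cons a us)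
      have "sz a \<le> (sz x + 2) ^ kl" using sz_mem[of a "l x"] Cons.prems kl[OF x] by fastforce
      then have "(sz x + sz a + 5) ^ k \<le> ?B" by (intro power_mono) auto
      then have "sz (st x a acc) \<le> sz acc + ?B" using add[of x a acc] by linarith
      then show ?case using Cons.IH[of "st x a acc"] Cons.prems by simp
    qed simp
    from this[of us "i x"] have "sz (fold (st x) us (i x)) \<le> sz (i x) + length us * ?B"
      using eq by simp
    also have "\<dots> \<le> (sz x + 2) ^ ki + (sz x + 2) ^ kl * ?B"
    proof (intro add_mono mult_le_mono le_refl)
      have "length us \<le> length (l x)" using eq by simp
      then show "length us \<le> (sz x + 2) ^ kl" using length_le_sz[of "l x"] kl[OF x] by linarith
    qed (rule ki[OF x])
    finally show "sz (fold (st x) us (i x)) \<le> (sz x + 2) ^ ki + (sz x + 2) ^ kl * ?B" .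
  qed
qed

section \<open>List operations, bounded quantifiers and multisets\<close>

lemma ptime_rev [ptime_intros]:
  assumes "ptime D f"
  shows "ptime D (\<lambda>x. rev (f x))"
proof -
  have "ptime D (\<lambda>x. fold (\<lambda>a acc. a # acc) (f x) [])"
    by (rule ptime_fold_additive[where k = 1, OF assms]) (auto intro!: ptime_intros)
  then show ?thesis by (simp add: rev_conv_fold)
qed

lemma ptime_append [ptime_intros]:
  assumes "ptime D f" "ptime D g"
  shows "ptime D (\<lambda>x. f x @ g x)"
proof -
  have "ptime D (\<lambda>x. fold (\<lambda>a acc. a # acc) (rev (f x)) (g x))"
    by (rule ptime_fold_additive[where k = 1]) (auto intro!: ptime_intros assms)
  then show ?thesis by (simp add: fold_Cons_rev)
qed

lemma fold_append_map: "fold (\<lambda>a acc. acc @ h a) xs acc = acc @ concat (map h xs)"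
  by (induction xs arbitrary: acc) auto

text \<open>The mapped function may use the outer argument; its dependence on both arguments is
  expressed on the pair. In this form the rules pass under nested binders.\<close>

lemma ptime_concat_map [ptime_intros]:
  assumes l: "ptime D l" and h: "ptime UNIV (\<lambda>z. h (fst z) (snd z))"
  shows "ptime D (\<lambda>x. concat (map (h x) (l x)))"
proof -
  obtain k where k: "\<And>z. sz (h (fst z) (snd z)) \<le> (sz z + 2) ^ k"
    using ptime_size[OF h] by (metis UNIV_I)
  have h': "ptime UNIV (\<lambda>z. h (f1 z) (f2 z))" if "ptime UNIV f1" "ptime UNIV f2"
    for f1 :: "('a \<times> 'b \<times> 'c list) \<Rightarrow> _" and f2
    using ptime_comp_UNIV[OF h ptime_Pair[OF that]] by simp
  have "ptime D (\<lambda>x. fold (\<lambda>a acc. acc @ h x a) (l x) [])"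
  proof (rule ptime_fold_additive[OF l, where k = k])
    show "sz (acc @ h x a) \<le> sz acc + (sz x + sz a + 5) ^ k" for x a acc
      using k[of "(x, a)"] sz_append[of acc "h x a"] by (simp add: numeral_eq_Suc)
  qed (intro ptime_intros h')+
  then show ?thesis by (simp add: fold_append_map)
qed

lemma ptime_map [ptime_intros]:
  assumes l: "ptime D l" and h: "ptime UNIV (\<lambda>z. h (fst z) (snd z))"
  shows "ptime D (\<lambda>x. map (h x) (l x))"
proof -
  have "ptime D (\<lambda>x. concat (map (\<lambda>a. [h x a]) (l x)))"
    by (intro ptime_intros l h)
  then show ?thesis by simp
qed

lemma ptime_filter [ptime_intros]:
  assumes l: "ptime D l" and P: "ptime UNIV (\<lambda>z. P (fst z) (snd z))"
  shows "ptime D (\<lambda>x. filter (P x) (l x))"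
proof -
  have "ptime D (\<lambda>x. concat (map (\<lambda>a. if P x a then [a] else []) (l x)))"
    by (intro ptime_intros l P)
  moreover have "concat (map (\<lambda>a. if Q a then [a] else []) xs) = filter Q xs" for Q and xs :: "'b list"
    by (induction xs) auto
  ultimately show ?thesis by simp
qed

lemma ptime_Ball [ptime_intros]:
  assumes l: "ptime D l" and P: "ptime UNIV (\<lambda>z. P (fst z) (snd z))"
  shows "ptime D (\<lambda>x. \<forall>a\<in>set (l x). P x a)"
proof -
  have "ptime D (\<lambda>x. filter (\<lambda>a. \<not> P x a) (l x) = [])"
    by (intro ptime_intros l P)
  then show ?thesis by (simp add: filter_empty_conv)
qed

lemma ptime_Bex [ptime_intros]:
  assumes l: "ptime D l" and P: "ptime UNIV (\<lambda>z. P (fst z) (snd z))"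
  shows "ptime D (\<lambda>x. \<exists>a\<in>set (l x). P x a)"
proof -
  have "ptime D (\<lambda>x. \<not> (\<forall>a\<in>set (l x). \<not> P x a))"
    by (intro ptime_intros l P)
  then show ?thesis by simp
qed

lemma ptime_mem [ptime_intros]:
  assumes "ptime D f" "ptime D l"
  shows "ptime D (\<lambda>x. f x \<in> set (l x))"
proof -
  have "ptime UNIV (\<lambda>z::'b \<times> 'b list. \<exists>b\<in>set (snd z). b = fst z)"
    by (intro ptime_intros)
  from ptime_comp_UNIV[OF this ptime_Pair[OF assms]] show ?thesis by simp
qed

lemma ptime_remdups [ptime_intros]:
  assumes "ptime D f"
  shows "ptime D (\<lambda>x. remdups (f x))"
proof -
  have "ptime D (\<lambda>x. fold (\<lambda>a acc. if a \<in> set acc then acc else a # acc) (rev (f x)) [])"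
    by (rule ptime_fold_additive[where k = 1])
      (auto intro: trans_le_add1 intro!: ptime_intros assms)
  moreover have "fold (\<lambda>a acc. if a \<in> set acc then acc else a # acc) (rev xs) [] = remdups xs"
    for xs :: "'b list"
    by (induction xs) auto
  ultimately show ?thesis by simp
qed

text \<open>Multiplicities are compared without arithmetic: two lists of copies of \<open>a\<close>
  are equal iff they are equally long.\<close>

lemma ptime_mset_eq:
  assumes "ptime D f" "ptime D g"
  shows "ptime D (\<lambda>x. mset (f x) = mset (g x))"
proof -
  have "mset xs = mset ys \<longleftrightarrow> (\<forall>a\<in>set (xs @ ys). filter (\<lambda>b. b = a) xs = filter (\<lambda>b. b = a) ys)"
    for xs ys :: "'b list"
  proof -
    have rep: "filter (\<lambda>b. b = a) zs = replicate (count (mset zs) a) a" for a and zs :: "'b list"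
      by (induction zs) auto
    show ?thesis
      unfolding rep multiset_eq_iff by auto (metis UnI1 UnI2 count_eq_zero_iff set_mset_mset)
  qed
  moreover have "ptime UNIV (\<lambda>z. \<forall>a\<in>set (fst z @ snd z).
      filter (\<lambda>b. b = a) (fst z) = filter (\<lambda>b. b = a) (snd z :: 'b list))"
    by (intro ptime_intros)
  ultimately have "ptime UNIV (\<lambda>z. mset (fst z) = mset (snd z :: 'b list))" by simp
  from ptime_comp_UNIV[OF this ptime_Pair[OF assms]] show ?thesis by simp
qed

section \<open>From polynomial-time functions to Turing machines\<close>

lemma map_code_nat_tree: "map sym_nat (code (nat_tree n)) = bits n @ [4]"
proof (induction n rule: bits.induct)
  case (1 n)
  show ?case
  proof (cases "n = 0")
    case True
    then show ?thesis by (simp add: nat_tree.simps)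
  next
    case False
    then have "sym_nat (Bit (odd n)) = n mod 2 + 1"
      by (cases "odd n") (auto simp: odd_iff_mod_2_eq_one)
    then show ?thesis using False 1
      by (subst nat_tree.simps, subst bits.simps) simp
  qed
qed

lemma enc_nat_cd: "enc_nat n = 3 # map sym_nat (cd n)"
  by (simp add: enc_nat_def cd_def to_tree_nat_def map_code_nat_tree)

lemma enc_list_cd:
  assumes "\<And>x. f x = 3 # map sym_nat (cd x)"
  shows "enc_list f xs = 3 # map sym_nat (cd xs)"
  unfolding enc_list_def by (induction xs) (auto simp: cd_simps assms)

lemma enc_pair_cd:
  assumes "\<And>x. f x = 3 # map sym_nat (cd x)" "\<And>x. g x = 3 # map sym_nat (cd x)"
  shows "enc_pair f g x = 3 # map sym_nat (cd x)"
  by (cases x) (simp add: enc_pair_def cd_simps assms)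

text \<open>Since the encoding is the code behind one extra bracket, a single \<open>Pop RA\<close>
  prepares the input tape for any program on the code of an instance.\<close>

lemma enc_inst_cd: "enc_inst I = map sym_nat (Op # cd I)"
proof -
  note enc = enc_list_cd enc_pair_cd enc_nat_cd
  have "enc_list (enc_pair enc_nat (enc_pair (enc_list enc_nat)
                 (enc_pair (enc_list enc_nat) (enc_list enc_nat)))) (acts I) = 3 # map sym_nat (cd (acts I))"
    by (intro enc)
  moreover have "enc_list (enc_pair enc_nat enc_nat) xs = 3 # map sym_nat (cd xs)" for xs
    by (intro enc)
  moreover have "enc_list enc_nat xs = 3 # map sym_nat (cd xs)" for xs
    by (intro enc)
  ultimately show ?thesis
    by (simp add: enc_inst_def cd_def to_tree_pv_inst_def)
qed

theorem ptime_imp_tm: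
  fixes f :: "pv_inst \<Rightarrow> bool"
  assumes "ptime D f"
  shows "\<exists>M c k. tm_wf M \<and>
    (\<forall>I\<in>D. tm_state_after M (enc_inst I) (c * length (enc_inst I) ^ k + c) = (if f I then 1 else 2))"
proof -
  obtain p j where p: "\<And>I u. I \<in> D \<Longrightarrow> runs p (mstk (cd I @ u)) ((sz I + 2) ^ j) (mstk (cd (f I) @ u))"
    using ptimeE[OF assms] by metis
  obtain M where M: "tm_wf M"
    "\<And>x t s' m. exec (Pop RA ;; p) (init_stacks x) t s' \<Longrightarrow> t * (2 * (length x + t) + 4) + 3 \<le> m \<Longrightarrow>
       tm_state_after M (map sym_nat x) m = (if tops s' RA = Some Cl then 2 else 1)"
    using ex_tm_exec[of "Pop RA ;; p"] by metis
  define T where "T n = Suc (1 + (n + 2) ^ j)" for n :: nat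
  have "pbd (\<lambda>n. T n * (2 * (n + T n) + 4) + 3)"
    unfolding T_def by (intro pbd_intros)
  then obtain k where k: "\<And>n. T n * (2 * (n + T n) + 4) + 3 \<le> (n + 2) ^ k"
    unfolding pbd_def by blast
  have "tm_state_after M (enc_inst I) (3 ^ k * length (enc_inst I) ^ k + 3 ^ k) = (if f I then 1 else 2)"
    if "I \<in> D" for I
  proof -
    let ?n = "length (enc_inst I)"
    have n: "?n = Suc (sz I)" by (simp add: enc_inst_cd sz_def)
    have "runs (Pop RA ;; p) (mstk (Op # cd I @ [])) (Suc (1 + (sz I + 2) ^ j)) (mstk (cd (f I) @ []))"
      by (rule runs_Seq[OF runs_pop_sym p[OF that]])
    then have "runs (Pop RA ;; p) (init_stacks (Op # cd I)) (T ?n) (mstk (cd (f I)))"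
      unfolding init_stacks_stk append_Nil2
      by (rule runs_mono) (auto simp: T_def n intro: power_mono)
    then obtain t where t: "t \<le> T ?n" "exec (Pop RA ;; p) (init_stacks (Op # cd I)) t (mstk (cd (f I)))"
      by (auto simp: runs_def)
    have "t * (2 * (length (Op # cd I) + t) + 4) + 3 \<le> T ?n * (2 * (?n + T ?n) + 4) + 3"
      using t(1) by (intro add_mono mult_le_mono le_refl) (auto simp: n sz_def)
    also have "\<dots> \<le> (?n + 2) ^ k" by (rule k)
    \<comment> \<open>The encoding is nonempty, so \<open>?n + 2\<close> is at most
      \<open>3 * ?n\<close>; this brings the bound into the form \<open>c * n ^ k + c\<close> with
      \<open>c = 3 ^ k\<close>.\<close>
    also have "\<dots> \<le> (3 * ?n) ^ k" using n by (intro power_mono) auto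
    also have "\<dots> \<le> 3 ^ k * ?n ^ k + 3 ^ k" by (simp add: power_mult_distrib)
    finally show ?thesis
      using M(2)[OF t(2)] by (cases "f I") (auto simp: enc_inst_cd tops_apply cd_simps)
  qed
  then show ?thesis using M(1) by blast
qed

section \<open>Linearizations and subsequences of the plan\<close>

lemma is_linearization_Nil: "is_linearization X R [] \<longleftrightarrow> X = {}"
  by (auto simp: is_linearization_def)

lemma is_linearization_Cons:
  "is_linearization X R (t # ts) \<longleftrightarrow>
     t \<in> X \<and> (\<forall>u\<in>X - {t}. (u, t) \<notin> R) \<and> is_linearization (X - {t}) R ts"
proof
  assume lin: "is_linearization X R (t # ts)"
  then have X: "distinct (t # ts)" "X = insert t (set ts)"
    and ord: "\<And>i j. i < j \<Longrightarrow> j < length (t # ts) \<Longrightarrow> ((t # ts) ! j, (t # ts) ! i) \<notin> R"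
    by (auto simp: is_linearization_def)
  have "(u, t) \<notin> R" if "u \<in> X - {t}" for u
  proof -
    have "u \<in> set ts" using that X(2) by auto
    then obtain j where "j < length ts" "u = ts ! j" by (auto simp: in_set_conv_nth)
    then show ?thesis using ord[of 0 "Suc j"] by simp
  qed
  moreover have "(ts ! j, ts ! i) \<notin> R" if "i < j" "j < length ts" for i j
    using ord[of "Suc i" "Suc j"] that by simp
  ultimately show "t \<in> X \<and> (\<forall>u\<in>X - {t}. (u, t) \<notin> R) \<and> is_linearization (X - {t}) R ts"
    using X by (auto simp: is_linearization_def)
next
  assume r: "t \<in> X \<and> (\<forall>u\<in>X - {t}. (u, t) \<notin> R) \<and> is_linearization (X - {t}) R ts"
  then have ts: "distinct ts" "set ts = X - {t}"
    and ord: "\<And>i j. i < j \<Longrightarrow> j < length ts \<Longrightarrow> (ts ! j, ts ! i) \<notin> R"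
    by (auto simp: is_linearization_def)
  have "((t # ts) ! j, (t # ts) ! i) \<notin> R" if "i < j" "j < length (t # ts)" for i j
  proof (cases i)
    case 0
    then have "(t # ts) ! j \<in> X - {t}" using that ts by (cases j) (auto simp flip: ts(2))
    then show ?thesis using 0 r by simp
  next
    case (Suc i')
    then show ?thesis using that ord[of i' "j - 1"] by (cases j) auto
  qed
  then show "is_linearization X R (t # ts)"
    using r ts by (auto simp: is_linearization_def)
qed

definition realizes :: "('a \<times> 'a) set \<Rightarrow> ('a \<Rightarrow> 'b) \<Rightarrow> 'a set \<Rightarrow> 'b list \<Rightarrow> bool" where
  "realizes R \<alpha> X p \<longleftrightarrow> (\<exists>ts. is_linearization X R ts \<and> map \<alpha> ts = p)"

text \<open>The letters of \<open>p\<close> that the subsequence skips are the ones to be supplied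
  by isolated tasks.\<close>

definition embeds :: "('a \<times> 'a) set \<Rightarrow> ('a \<Rightarrow> 'b) \<Rightarrow> 'a set \<Rightarrow> 'b list \<Rightarrow> bool" where
  "embeds R \<alpha> X p \<longleftrightarrow> (\<exists>ts. is_linearization X R ts \<and> subseq (map \<alpha> ts) p)"

lemma realizes_Nil: "realizes R \<alpha> X [] \<longleftrightarrow> X = {}"
  by (auto simp: realizes_def is_linearization_Nil)

lemma realizes_Cons:
  "realizes R \<alpha> X (b # p) \<longleftrightarrow>
     (\<exists>t\<in>X. \<alpha> t = b \<and> (\<forall>u\<in>X - {t}. (u, t) \<notin> R) \<and> realizes R \<alpha> (X - {t}) p)"
proof
  assume "realizes R \<alpha> X (b # p)"
  then obtain t ts where "is_linearization X R (t # ts)" "\<alpha> t = b" "map \<alpha> ts = p"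
    by (auto simp: realizes_def map_eq_Cons_conv)
  then show "\<exists>t\<in>X. \<alpha> t = b \<and> (\<forall>u\<in>X - {t}. (u, t) \<notin> R) \<and> realizes R \<alpha> (X - {t}) p"
    unfolding is_linearization_Cons realizes_def by blast
next
  assume "\<exists>t\<in>X. \<alpha> t = b \<and> (\<forall>u\<in>X - {t}. (u, t) \<notin> R) \<and> realizes R \<alpha> (X - {t}) p"
  then obtain t ts where "is_linearization X R (t # ts)" "\<alpha> t = b" "map \<alpha> ts = p"
    unfolding realizes_def is_linearization_Cons by blast
  then show "realizes R \<alpha> X (b # p)"
    unfolding realizes_def by (intro exI[of _ "t # ts"]) simp
qed

lemma embeds_Nil: "embeds R \<alpha> X [] \<longleftrightarrow> X = {}"
  by (auto simp: embeds_def is_linearization_Nil intro!: exI[of _ "[]"] dest!: list_emb_Nil2)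

lemma embeds_Cons:
  "embeds R \<alpha> X (b # p) \<longleftrightarrow> embeds R \<alpha> X p \<or>
     (\<exists>t\<in>X. \<alpha> t = b \<and> (\<forall>u\<in>X - {t}. (u, t) \<notin> R) \<and> embeds R \<alpha> (X - {t}) p)"
    (is "?l \<longleftrightarrow> ?r")
proof
  assume ?l
  then obtain ts where ts: "is_linearization X R ts" "subseq (map \<alpha> ts) (b # p)"
    by (auto simp: embeds_def)
  show ?r
  proof (cases "subseq (map \<alpha> ts) p")
    case True
    then show ?thesis using ts by (auto simp: embeds_def)
  next
    case False
    then obtain t ts' where t: "ts = t # ts'" by (cases ts) auto
    then have "\<alpha> t = b" "subseq (map \<alpha> ts') p"
      using ts(2) False by (auto split: if_splits)
    then show ?thesis using ts(1) unfolding t is_linearization_Cons embeds_def by blast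
  qed
next
  assume ?r
  then show ?l
  proof
    assume "embeds R \<alpha> X p"
    then show ?l unfolding embeds_def by (meson list_emb_Cons)
  next
    assume "\<exists>t\<in>X. \<alpha> t = b \<and> (\<forall>u\<in>X - {t}. (u, t) \<notin> R) \<and> embeds R \<alpha> (X - {t}) p"
    then obtain t ts where "is_linearization X R (t # ts)" "\<alpha> t = b" "subseq (map \<alpha> ts) p"
      unfolding embeds_def is_linearization_Cons by blast
    then show ?l unfolding embeds_def by (intro exI[of _ "t # ts"]) simp
  qed
qed

lemma subseq_imp_mset_subset: "subseq xs ys \<Longrightarrow> mset xs \<subseteq># mset ys"
proof (induction rule: list_emb.induct)
  case (list_emb_Cons xs ys y)
  then show ?case by (simp add: subset_mset.order_trans)
qed auto

lemma embeds_mset: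
  assumes "embeds R \<alpha> X p"
  shows "image_mset \<alpha> (mset_set X) \<subseteq># mset p"
proof -
  obtain ts where ts: "is_linearization X R ts" "subseq (map \<alpha> ts) p"
    using assms by (auto simp: embeds_def)
  then have "mset_set X = mset ts" by (auto simp: is_linearization_def mset_set_set)
  then show ?thesis using subseq_imp_mset_subset[OF ts(2)] by simp
qed

text \<open>Isolated elements can be placed anywhere, so only their labels matter: they must fill exactly
  the positions that are left over by the other elements.\<close>

lemma realizes_iff_embeds:
  assumes "finite A" "finite U" "A \<inter> U = {}" "\<And>u x. u \<in> U \<Longrightarrow> (x, u) \<notin> R \<and> (u, x) \<notin> R"
  shows "realizes R \<alpha> (A \<union> U) p \<longleftrightarrow>
    embeds R \<alpha> A p \<and> image_mset \<alpha> (mset_set (A \<union> U)) = mset p"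
  using assms
proof (induction p arbitrary: A U)
  case Nil
  then show ?case by (auto simp: realizes_Nil embeds_Nil mset_set_empty_iff)
next
  case (Cons b p)
  have remove: "image_mset \<alpha> (mset_set (A \<union> U)) = add_mset (\<alpha> t) (image_mset \<alpha> (mset_set ((A \<union> U) - {t})))"
    if "t \<in> A \<union> U" for t
    using that Cons.prems(1,2) by (simp add: mset_set.remove[of "A \<union> U" t])
  have IH_A: "realizes R \<alpha> ((A \<union> U) - {t}) p \<longleftrightarrow>
      embeds R \<alpha> (A - {t}) p \<and> image_mset \<alpha> (mset_set ((A \<union> U) - {t})) = mset p" if "t \<in> A" for t
  proof -
    have "(A \<union> U) - {t} = (A - {t}) \<union> U" using that Cons.prems(3) by auto
    then show ?thesis using Cons.IH[of "A - {t}" U] Cons.prems by auto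
  qed
  have IH_U: "realizes R \<alpha> ((A \<union> U) - {t}) p \<longleftrightarrow>
      embeds R \<alpha> A p \<and> image_mset \<alpha> (mset_set ((A \<union> U) - {t})) = mset p" if "t \<in> U" for t
  proof -
    have "(A \<union> U) - {t} = A \<union> (U - {t})" using that Cons.prems(3) by auto
    then show ?thesis using Cons.IH[of A "U - {t}"] Cons.prems by auto
  qed
  show ?case
  proof
    assume "realizes R \<alpha> (A \<union> U) (b # p)"
    then obtain t where t: "t \<in> A \<union> U" "\<alpha> t = b" "\<forall>u\<in>A \<union> U - {t}. (u, t) \<notin> R"
      "realizes R \<alpha> (A \<union> U - {t}) p"
      unfolding realizes_Cons by blast
    then have "image_mset \<alpha> (mset_set ((A \<union> U) - {t})) = mset p"
      using IH_A IH_U by blast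
    then have "image_mset \<alpha> (mset_set (A \<union> U)) = mset (b # p)"
      using remove[OF t(1)] t(2) by simp
    moreover have "embeds R \<alpha> A (b # p)"
      using t IH_A[of t] IH_U[of t] unfolding embeds_Cons by blast
    ultimately show "embeds R \<alpha> A (b # p) \<and> image_mset \<alpha> (mset_set (A \<union> U)) = mset (b # p)"
      by blast
  next
    assume r: "embeds R \<alpha> A (b # p) \<and> image_mset \<alpha> (mset_set (A \<union> U)) = mset (b # p)"
    then consider t where "t \<in> A" "\<alpha> t = b" "\<forall>u\<in>A - {t}. (u, t) \<notin> R" "embeds R \<alpha> (A - {t}) p"
      | "embeds R \<alpha> A p"
      unfolding embeds_Cons by blast
    then show "realizes R \<alpha> (A \<union> U) (b # p)"
    proof cases
      case 1
      then have "image_mset \<alpha> (mset_set ((A \<union> U) - {t})) = mset p"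
        using r remove[of t] by simp
      then have "realizes R \<alpha> ((A \<union> U) - {t}) p" using IH_A 1 by blast
      moreover have "\<forall>u\<in>A \<union> U - {t}. (u, t) \<notin> R" using 1(3) Cons.prems(4) by blast
      ultimately show ?thesis using 1 unfolding realizes_Cons by blast
    next
      case 2
      have "mset_set (A \<union> U) = mset_set A + mset_set U"
        using Cons.prems by (intro mset_set_Union) auto
      then have eq: "image_mset \<alpha> (mset_set A) + image_mset \<alpha> (mset_set U) = add_mset b (mset p)"
        using r by simp
      \<comment> \<open>Here \<open>A\<close> fits into \<open>p\<close>, which contains one
        \<open>b\<close> fewer than \<open>b # p\<close>. So \<open>A\<close> cannot account for all
        occurrences of \<open>b\<close>, and some element of \<open>U\<close> with this label is
        left for the first position.\<close>
      have "b \<in># image_mset \<alpha> (mset_set U)"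
      proof (rule ccontr)
        assume "b \<notin># image_mset \<alpha> (mset_set U)"
        then have "count (image_mset \<alpha> (mset_set U)) b = 0" by (simp only: not_in_iff)
        moreover have "count (image_mset \<alpha> (mset_set A)) b + count (image_mset \<alpha> (mset_set U)) b =
            Suc (count (mset p) b)"
          unfolding count_union[symmetric] eq by simp
        ultimately show False using mset_subset_eq_count[OF embeds_mset[OF 2], of b] by linarith
      qed
      then obtain u where u: "u \<in> U" "\<alpha> u = b" using Cons.prems(2) by auto
      then have "image_mset \<alpha> (mset_set ((A \<union> U) - {u})) = mset p"
        using r remove[of u] by simp
      then have "realizes R \<alpha> ((A \<union> U) - {u}) p" using IH_U 2 u by blast
      then show ?thesis using u Cons.prems(4) unfolding realizes_Cons by blast
    qed
  qed
qed

section \<open>The number of up-sets of a poset of bounded width\<close>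

text \<open>A subset with at most \<open>Suc w\<close> elements arises from one with at most
  \<open>w\<close> by inserting an element of \<open>S\<close> or nothing, whence the factor
  \<open>card S + 1\<close>.\<close>

lemma card_bounded_subsets:
  assumes "finite S"
  shows "finite {A. A \<subseteq> S \<and> card A \<le> w} \<and> card {A. A \<subseteq> S \<and> card A \<le> w} \<le> (card S + 1) ^ w"
proof (induction w)
  case 0
  have "{A. A \<subseteq> S \<and> card A \<le> 0} = {{}}" using assms by (auto dest: finite_subset)
  then show ?case by simp
next
  case (Suc w)
  let ?P = "\<lambda>w. {A. A \<subseteq> S \<and> card A \<le> w}"
  let ?f = "\<lambda>(a, A). case a of None \<Rightarrow> A | Some x \<Rightarrow> insert x A"
  have sub: "?P (Suc w) \<subseteq> ?f ` (insert None (Some ` S) \<times> ?P w)"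
  proof
    fix A assume A: "A \<in> ?P (Suc w)"
    show "A \<in> ?f ` (insert None (Some ` S) \<times> ?P w)"
    proof (cases "card A \<le> w")
      case True
      then show ?thesis using A by (intro image_eqI[of _ _ "(None, A)"]) auto
    next
      case False
      then obtain x where x: "x \<in> A" by (metis card.empty equals0I le0)
      have "card (A - {x}) \<le> w" using A x assms by (auto simp: card_Diff_singleton_if)
      then show ?thesis using A x
        by (intro image_eqI[of _ _ "(Some x, A - {x})"]) auto
    qed
  qed
  have fin: "finite (insert None (Some ` S) \<times> ?P w)" using Suc assms by simp
  have "card (?P (Suc w)) \<le> card (?f ` (insert None (Some ` S) \<times> ?P w))"
    using fin sub by (intro card_mono) auto
  also have "\<dots> \<le> card (insert None (Some ` S) \<times> ?P w)"
    using fin by (rule card_image_le)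
  also have "\<dots> = (card S + 1) * card (?P w)"
    using assms by (simp add: card_cartesian_product card_image)
  also have "\<dots> \<le> (card S + 1) ^ Suc w"
    unfolding power_Suc using Suc by (intro mult_le_mono le_refl) blast
  finally show ?case using finite_subset[OF sub] fin by simp
qed

definition upset_in :: "'a set \<Rightarrow> ('a \<times> 'a) set \<Rightarrow> 'a set \<Rightarrow> bool" where
  "upset_in S R U \<longleftrightarrow> U \<subseteq> S \<and> (\<forall>x\<in>U. \<forall>y\<in>S. (x, y) \<in> R \<longrightarrow> y \<in> U)"

text \<open>A finite strict order is well-founded, so each element of an up-set lies above or equals
  a minimal one. Thus \<open>mins\<close> is injective on up-sets, and its values are antichains; by
  symmetry it suffices to derive one inclusion from equal minimal elements.\<close>

lemma card_upsets:
  assumes "finite S" "finite R" "irrefl R" "trans R"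
    and width: "\<And>A. A \<subseteq> S \<Longrightarrow> antichain_of R A \<Longrightarrow> card A \<le> w"
  shows "finite {U. upset_in S R U} \<and> card {U. upset_in S R U} \<le> (card S + 1) ^ w"
proof -
  define mins where "mins U = {x\<in>U. \<forall>y\<in>U. (y, x) \<notin> R}" for U
  have "acyclic R" using assms(3,4) by (simp add: acyclic_irrefl)
  then have wf: "wf R" using assms(2) by (rule finite_acyclic_wf[rotated])
  have "U \<subseteq> V" if U: "upset_in S R U" and V: "upset_in S R V" and eq: "mins U = mins V" for U V
  proof
    fix x assume x: "x \<in> U"
    \<comment> \<open>A minimal element of the part of \<open>U\<close> weakly below
      \<open>x\<close> is minimal in all of \<open>U\<close>, by transitivity.\<close>
    then have "x \<in> {u\<in>U. u = x \<or> (u, x) \<in> R}" by simp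
    then obtain z where z: "z \<in> {u\<in>U. u = x \<or> (u, x) \<in> R}"
      "\<forall>y. (y, z) \<in> R \<longrightarrow> y \<notin> {u\<in>U. u = x \<or> (u, x) \<in> R}"
      using wf unfolding wf_eq_minimal by meson
    have "(y, z) \<notin> R" if "y \<in> U" for y
    proof
      assume "(y, z) \<in> R"
      moreover from this have "(y, x) \<in> R" using z(1) transD[OF assms(4)] by blast
      ultimately show False using z(2) that by blast
    qed
    then have "z \<in> mins U" using z(1) by (simp add: mins_def)
    then have "z \<in> V" using eq by (auto simp: mins_def)
    moreover have "x \<in> S" using x U by (auto simp: upset_in_def)
    ultimately show "x \<in> V" using z(1) V by (auto simp: upset_in_def)
  qed
  then have inj: "inj_on mins {U. upset_in S R U}"
    by (auto intro!: inj_onI)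
  have sub: "mins ` {U. upset_in S R U} \<subseteq> {A. A \<subseteq> S \<and> card A \<le> w}"
  proof (intro image_subsetI CollectI conjI)
    fix U assume "U \<in> {U. upset_in S R U}"
    then show "mins U \<subseteq> S" by (auto simp: mins_def upset_in_def)
    moreover have "antichain_of R (mins U)" by (auto simp: mins_def antichain_of_def)
    ultimately show "card (mins U) \<le> w" by (rule width)
  qed
  note fin = card_bounded_subsets[OF assms(1), of w]
  show ?thesis
    using inj_on_finite[OF inj sub] card_inj_on_le[OF inj sub] fin by (meson order_trans)
qed

section \<open>The algorithm\<close>

text \<open>For an irreflexive order on the tasks this is isolation, in a form that is checked by
  one pass over the listed pairs.\<close>

definition unordered :: "pv_inst \<Rightarrow> nat \<Rightarrow> bool" where
  "unordered I t \<longleftrightarrow> (\<forall>e\<in>set (ord I). fst e \<noteq> t \<and> snd e \<noteq> t)"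

definition core :: "pv_inst \<Rightarrow> nat list" where
  "core I = filter (\<lambda>t. \<not> unordered I t) (tasks I)"

definition next_tasks :: "pv_inst \<Rightarrow> nat \<Rightarrow> nat list \<Rightarrow> nat list" where
  "next_tasks I a ts = filter (\<lambda>t. (t, a) \<in> set (lab I) \<and> (\<forall>u\<in>set ts. (u, t) \<notin> set (ord I))) ts"

text \<open>Keeping \<open>F\<close> itself stands for leaving the letter \<open>a\<close> to an
  isolated task. Without \<open>remdups\<close> different orders of execution would leave many
  copies of the same remaining set.\<close>

definition extend :: "pv_inst \<Rightarrow> nat \<Rightarrow> nat list list \<Rightarrow> nat list list" where
  "extend I a F =
     remdups (F @ concat (map (\<lambda>ts. map (\<lambda>t. filter (\<lambda>u. u \<noteq> t) ts) (next_tasks I a ts)) F))"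

definition search :: "pv_inst \<Rightarrow> bool" where
  "search I \<longleftrightarrow> [] \<in> set (fold (extend I) (plan I) [core I])"

text \<open>These are the only propositions that can hold while the plan is executed. Every
  successor state is filtered from this fixed list, so its size stays bounded along the
  plan.\<close>

definition props :: "pv_inst \<Rightarrow> nat list" where
  "props I = init I @ concat (map (\<lambda>e. snd (snd (snd e))) (acts I))"

definition progress :: "pv_inst \<Rightarrow> nat \<Rightarrow> bool \<times> nat list \<Rightarrow> bool \<times> nat list" where
  "progress I a z =
    (fst z \<and> (\<forall>e\<in>set (acts I). fst e = a \<longrightarrow> (\<forall>f\<in>set (fst (snd e)). f \<in> set (snd z))),
     filter (\<lambda>f. f \<in> set (snd z) \<and> (\<forall>e\<in>set (acts I). fst e = a \<longrightarrow> f \<notin> set (fst (snd (snd e)))) \<or>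
        (\<exists>e\<in>set (acts I). fst e = a \<and> f \<in> set (snd (snd (snd e))))) (props I))"

definition verify :: "pv_inst \<Rightarrow> bool" where
  "verify I \<longleftrightarrow> fst (fold (progress I) (plan I) (True, init I)) \<and>
     mset (map snd (lab I)) = mset (plan I) \<and> search I"

subsection \<open>Correctness\<close>

lemma alpha_iff:
  assumes "valid_inst I" "t \<in> set (tasks I)"
  shows "(t, a) \<in> set (lab I) \<longleftrightarrow> alpha I t = a"
proof -
  have d: "distinct (map fst (lab I))" "t \<in> fst ` set (lab I)"
    using assms by (auto simp: valid_inst_def)
  then obtain b where "(t, b) \<in> set (lab I)" by auto
  then have "map_of (lab I) t = Some b" using d by simp
  moreover have "(t, a) \<in> set (lab I) \<longleftrightarrow> map_of (lab I) t = Some a"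
    using map_of_eq_Some_iff[OF d(1)] by simp
  ultimately show ?thesis by (auto simp: alpha_def)
qed

text \<open>Invariant of the search for an arbitrary frontier: success means that some member embeds
  the rest of the plan. One round of \<open>extend\<close> unfolds \<open>embeds_Cons\<close> for
  all members at once.\<close>

lemma search_iff:
  assumes "valid_inst I" "\<And>ts. ts \<in> set F \<Longrightarrow> set ts \<subseteq> set (tasks I)"
  shows "[] \<in> set (fold (extend I) p F) \<longleftrightarrow> (\<exists>ts\<in>set F. embeds (prec I) (alpha I) (set ts) p)"
  using assms(2)
proof (induction p arbitrary: F)
  case Nil
  then show ?case by (auto simp: embeds_Nil)
next
  case (Cons a p)
  have irr: "(t, t) \<notin> prec I" for t
    using assms(1) by (auto simp: valid_inst_def strict_po_on_def irrefl_def)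
  have set_extend: "set (extend I a F) =
      set F \<union> (\<Union>ts\<in>set F. (\<lambda>t. filter (\<lambda>u. u \<noteq> t) ts) ` set (next_tasks I a ts))"
    by (simp add: extend_def)
  have sub: "set ts \<subseteq> set (tasks I)" if ts: "ts \<in> set (extend I a F)" for ts
  proof -
    obtain us where "us \<in> set F" "set ts \<subseteq> set us" using ts unfolding set_extend by auto
    then show ?thesis using Cons.prems by blast
  qed
  have nxt: "t \<in> set (next_tasks I a ts) \<longleftrightarrow>
      t \<in> set ts \<and> alpha I t = a \<and> (\<forall>u\<in>set ts - {t}. (u, t) \<notin> prec I)" if "ts \<in> set F" for t ts
    using alpha_iff[OF assms(1), of t a] Cons.prems[OF that] irr[of t]
    unfolding next_tasks_def prec_def by auto
  have "[] \<in> set (fold (extend I) (a # p) F) \<longleftrightarrow>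
      (\<exists>ts\<in>set (extend I a F). embeds (prec I) (alpha I) (set ts) p)"
    using Cons.IH[OF sub] by simp
  also have "\<dots> \<longleftrightarrow> (\<exists>ts\<in>set F. embeds (prec I) (alpha I) (set ts) p \<or>
      (\<exists>t\<in>set (next_tasks I a ts). embeds (prec I) (alpha I) (set ts - {t}) p))"
  proof -
    have "{u \<in> set ts. u \<noteq> t} = set ts - {t}" for t :: nat and ts by auto
    then show ?thesis unfolding set_extend bex_Un by (simp add: bex_disj_distrib)
  qed
  also have "\<dots> \<longleftrightarrow> (\<exists>ts\<in>set F. embeds (prec I) (alpha I) (set ts) (a # p))"
    unfolding embeds_Cons using nxt by (intro bex_cong refl) blast
  finally show ?case .
qed

lemma set_props: "set (props I) = set (init I) \<union> (\<Union>e\<in>set (acts I). set (snd (snd (snd e))))"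
  by (simp add: props_def)

lemma executable_iff:
  assumes "valid_inst I" "set p \<subseteq> act_names I" "set s \<subseteq> set (props I)"
  shows "fst (fold (progress I) p (b, s)) \<longleftrightarrow> b \<and> executable I (set s) p"
  using assms(2,3)
proof (induction p arbitrary: b s)
  case (Cons a p)
  have "distinct (map fst (acts I))" using assms(1) by (simp add: valid_inst_def)
  moreover obtain pr d ad where mem: "(a, pr, d, ad) \<in> set (acts I)"
    using Cons.prems(1) by (auto simp: act_names_def)
  ultimately have look: "map_of (acts I) a = Some (pr, d, ad)" by simp
  have uniq: "e = (a, pr, d, ad)" if "e \<in> set (acts I)" "fst e = a" for e
  proof -
    have "map_of (acts I) (fst e) = Some (snd e)"
      using that(1) \<open>distinct (map fst (acts I))\<close> by (subst map_of_eq_Some_iff) auto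
    then have "snd e = (pr, d, ad)" using that(2) look by simp
    then show ?thesis using that(2) by (simp add: prod_eq_iff)
  qed
  \<comment> \<open>Exactly one entry is named \<open>a\<close>, so the quantifiers over entries in
    \<open>progress\<close> amount to a table lookup.\<close>
  have all: "(\<forall>e\<in>set (acts I). fst e = a \<longrightarrow> P e) \<longleftrightarrow> P (a, pr, d, ad)" for P
  proof (intro iffI ballI impI)
    assume "\<forall>e\<in>set (acts I). fst e = a \<longrightarrow> P e"
    from bspec[OF this mem] show "P (a, pr, d, ad)" by simp
  next
    fix e assume "P (a, pr, d, ad)" "e \<in> set (acts I)" "fst e = a"
    then show "P e" using uniq[of e] by simp
  qed
  have ex: "(\<exists>e\<in>set (acts I). fst e = a \<and> P e) \<longleftrightarrow> P (a, pr, d, ad)" for P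
    using all[of "\<lambda>e. \<not> P e"] by blast
  let ?s' = "snd (progress I a (b, s))"
  have "set ad \<subseteq> set (props I)" using mem unfolding set_props by fastforce
  then have s': "set ?s' = (set s - del_of I a) \<union> add_of I a"
    using Cons.prems(2) unfolding progress_def all ex by (auto simp: del_of_def add_of_def look)
  have b': "fst (progress I a (b, s)) \<longleftrightarrow> b \<and> pre_of I a \<subseteq> set s"
    unfolding progress_def all by (auto simp: pre_of_def look)
  have "set ?s' \<subseteq> set (props I)" by (auto simp: progress_def)
  then have "fst (fold (progress I) p (fst (progress I a (b, s)), ?s')) \<longleftrightarrow>
      fst (progress I a (b, s)) \<and> executable I (set ?s') p"
    using Cons.prems(1) by (intro Cons.IH) auto
  then show ?case unfolding prod.collapse using s' b' by simp
qed simp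

lemma verify_iff:
  assumes "valid_inst I"
  shows "verify I \<longleftrightarrow> plan_verification I"
proof -
  let ?U = "set (filter (unordered I) (tasks I))"
  have T: "set (tasks I) = set (core I) \<union> ?U" by (auto simp: core_def)
  have d: "distinct (map fst (lab I))" "set (map fst (lab I)) = set (tasks I)"
    using assms by (auto simp: valid_inst_def)
  \<comment> \<open>\<open>lab\<close> lists every task exactly once, so its second components are
    the labels of all tasks with the right multiplicities.\<close>
  have "image_mset (alpha I) (mset_set (set (tasks I))) = mset (map (alpha I \<circ> fst) (lab I))"
    unfolding d(2)[symmetric] mset_set_set[OF d(1)] by (simp add: multiset.map_comp)
  also have "map (alpha I \<circ> fst) (lab I) = map snd (lab I)"
    by (auto simp: alpha_def map_of_is_SomeI[OF d(1)])
  finally have labels: "image_mset (alpha I) (mset_set (set (core I) \<union> ?U)) = mset (map snd (lab I))"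
    unfolding T .
  have "plan_verification I \<longleftrightarrow>
      realizes (prec I) (alpha I) (set (core I) \<union> ?U) (plan I) \<and> executable I (set (init I)) (plan I)"
    unfolding plan_verification_def realizes_def T by blast
  also have "realizes (prec I) (alpha I) (set (core I) \<union> ?U) (plan I) \<longleftrightarrow>
      embeds (prec I) (alpha I) (set (core I)) (plan I) \<and> mset (map snd (lab I)) = mset (plan I)"
    unfolding labels[symmetric]
  proof (rule realizes_iff_embeds)
    show "(x, u) \<notin> prec I \<and> (u, x) \<notin> prec I" if "u \<in> ?U" for u x
    proof -
      have "fst e \<noteq> u \<and> snd e \<noteq> u" if "e \<in> prec I" for e
        using \<open>u \<in> ?U\<close> that by (simp add: unordered_def prec_def)
      from this[of "(x, u)"] this[of "(u, x)"] show ?thesis by auto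
    qed
  qed (auto simp: core_def)
  also have "embeds (prec I) (alpha I) (set (core I)) (plan I) \<longleftrightarrow> search I"
    unfolding search_def using search_iff[OF assms, of "[core I]" "plan I"]
    by (auto simp: core_def)
  also have "executable I (set (init I)) (plan I) \<longleftrightarrow> fst (fold (progress I) (plan I) (True, init I))"
    using executable_iff[OF assms, of "plan I" "init I" True] assms
    by (auto simp: valid_inst_def set_props)
  finally show ?thesis unfolding verify_def by blast
qed

subsection \<open>Running time\<close>

lemma sz_filter: "sz (filter P xs) \<le> sz xs"
  by (induction xs) auto

lemma sz_list_bound: "(\<And>x. x \<in> set xs \<Longrightarrow> sz x \<le> n) \<Longrightarrow> sz xs \<le> 1 + length xs * (n + 1)"
proof (induction xs)
  case (Cons x xs)
  then have "sz xs \<le> 1 + length xs * (n + 1)" "sz x \<le> n" by auto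
  then show ?case by simp
qed simp

lemma sz_components: "sz (tasks I) \<le> sz I" "sz (init I) \<le> sz I"
  unfolding sz_def cd_def to_tree_pv_inst_def by (simp_all del: length_cd)

text \<open>A task in a pair of the irreflexive order has a distinct comparable partner, so the core
  consists of non-isolated tasks. An antichain of \<open>prec I\<close> remains one for the
  restricted order, hence is among the sets whose cardinalities define the width.\<close>

lemma antichain_core_card:
  assumes "valid_inst I" "gen_po_width (set (tasks I)) (prec I) \<le> w"
    and "A \<subseteq> set (core I)" "antichain_of (prec I) A"
  shows "card A \<le> w"
proof -
  let ?S = "{x \<in> set (tasks I). \<not> isolated (set (tasks I)) (prec I) x}"
  let ?R = "prec I \<inter> (?S \<times> ?S)"
  have po: "prec I \<subseteq> set (tasks I) \<times> set (tasks I)" "irrefl (prec I)"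
    using assms(1) by (auto simp: valid_inst_def strict_po_on_def)
  have "set (core I) \<subseteq> ?S"
  proof
    fix t assume "t \<in> set (core I)"
    then obtain u v where t: "t \<in> set (tasks I)" "(u, v) \<in> prec I" "u = t \<or> v = t"
      by (auto simp: core_def unordered_def prec_def)
    have "u \<noteq> v" "u \<in> set (tasks I)" "v \<in> set (tasks I)"
      using t(2) po by (auto simp: irrefl_def)
    then have "\<not> isolated (set (tasks I)) (prec I) t"
      unfolding isolated_def using t(2,3) by metis
    then show "t \<in> ?S" using t(1) by simp
  qed
  then have "card A \<in> card ` {A. A \<subseteq> ?S \<and> antichain_of ?R A}"
    using assms(3,4) by (intro imageI) (auto simp: antichain_of_def)
  moreover have "finite {A. A \<subseteq> ?S \<and> antichain_of ?R A}" by simp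
  ultimately have "card A \<le> po_width ?S ?R"
    unfolding po_width_def by (intro Max_ge) auto
  then show ?thesis using assms(2) by (simp add: gen_po_width_def Let_def)
qed

text \<open>The equation fixes the order and multiplicity of the entries: \<open>ts\<close> is
  determined by its set, so distinct lists in the frontier are distinct up-sets.\<close>

definition frontier_ok :: "pv_inst \<Rightarrow> nat list \<Rightarrow> bool" where
  "frontier_ok I ts \<longleftrightarrow>
     ts = filter (\<lambda>t. t \<in> set ts) (core I) \<and> upset_in (set (core I)) (prec I) (set ts)"

text \<open>Only a task without predecessors in \<open>us\<close> is removed. No remaining task lies
  below it, so what remains is still closed upwards.\<close>

lemma frontier_ok_extend:
  assumes "\<forall>ts\<in>set F. frontier_ok I ts" "ts \<in> set (extend I a F)"
  shows "frontier_ok I ts"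
proof -
  consider "ts \<in> set F" | us t where "us \<in> set F" "t \<in> set (next_tasks I a us)" "ts = filter (\<lambda>u. u \<noteq> t) us"
    using assms(2) by (auto simp: extend_def)
  then show ?thesis
  proof cases
    case 2
    then have us: "us = filter (\<lambda>t. t \<in> set us) (core I)"
      "upset_in (set (core I)) (prec I) (set us)"
      using assms(1) by (auto simp: frontier_ok_def)
    have "ts = filter (\<lambda>u. u \<noteq> t) (filter (\<lambda>t. t \<in> set us) (core I))"
      unfolding 2(3) by (subst us(1)) simp
    then have "ts = filter (\<lambda>u. u \<in> set us \<and> u \<noteq> t) (core I)"
      by (simp add: conj_commute)
    moreover have ts: "set ts = set us - {t}" using 2(3) by auto
    moreover have "upset_in (set (core I)) (prec I) (set us - {t})"
      using us(2) 2(2) unfolding upset_in_def next_tasks_def prec_def by auto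
    ultimately show ?thesis by (simp add: frontier_ok_def)
  qed (use assms in auto)
qed

lemma frontier_fold:
  "\<forall>ts\<in>set F. frontier_ok I ts \<Longrightarrow> distinct F \<Longrightarrow>
   (\<forall>ts\<in>set (fold (extend I) p F). frontier_ok I ts) \<and> distinct (fold (extend I) p F)"
proof (induction p arbitrary: F)
  case (Cons a p)
  have "\<forall>ts\<in>set (extend I a F). frontier_ok I ts" using Cons.prems frontier_ok_extend by blast
  moreover have "distinct (extend I a F)" by (simp add: extend_def)
  ultimately show ?case using Cons.IH by simp
qed simp

text \<open>Here the width enters the running time: the frontier has one list for each of at most
  \<open>(sz I + 1) ^ w\<close> up-sets, and each list, being a sublist of the core, is no larger
  than the instance.\<close>

lemma sz_frontier:
  assumes I: "valid_inst I" "gen_po_width (set (tasks I)) (prec I) \<le> w"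
  shows "sz (fold (extend I) p [core I]) \<le> 1 + (sz I + 1) ^ w * (sz I + 1)"
proof -
  let ?F = "fold (extend I) p [core I]"
  have "frontier_ok I (core I)"
    unfolding frontier_ok_def
    by (intro conjI filter_True[symmetric]) (simp_all add: upset_in_def)
  then have "\<forall>ts\<in>set [core I]. frontier_ok I ts" "distinct [core I]" by simp_all
  from frontier_fold[OF this, of p] have F: "\<forall>ts\<in>set ?F. frontier_ok I ts" "distinct ?F"
    by blast+
  have core: "sz (core I) \<le> sz I"
    using sz_filter[of _ "tasks I"] sz_components(1)[of I] unfolding core_def by (meson order_trans)
  have "sz ts \<le> sz I" if "ts \<in> set ?F" for ts
  proof -
    have eq: "ts = filter (\<lambda>t. t \<in> set ts) (core I)"
      using bspec[OF F(1) that] unfolding frontier_ok_def by (rule conjunct1)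
    have "sz ts \<le> sz (core I)"
      using sz_filter[of "\<lambda>t. t \<in> set ts" "core I"] unfolding eq[symmetric] .
    then show ?thesis using core by linarith
  qed
  then have "sz ?F \<le> 1 + length ?F * (sz I + 1)" by (rule sz_list_bound)
  moreover have "length ?F \<le> (sz I + 1) ^ w"
  proof -
    have po: "irrefl (prec I)" "trans (prec I)" "finite (prec I)"
      using I(1) by (auto simp: valid_inst_def strict_po_on_def prec_def)
    have ups: "finite {U. upset_in (set (core I)) (prec I) U}"
      "card {U. upset_in (set (core I)) (prec I) U} \<le> (card (set (core I)) + 1) ^ w"
      using card_upsets[of "set (core I)" "prec I" w] po antichain_core_card[OF I] by auto
    have inj: "inj_on set (set ?F)"
    proof (rule inj_onI)
      fix us vs assume mem: "us \<in> set ?F" "vs \<in> set ?F" and "set us = set vs"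
      then have eq: "filter (\<lambda>t. t \<in> set us) (core I) = filter (\<lambda>t. t \<in> set vs) (core I)" by simp
      have 1: "us = filter (\<lambda>t. t \<in> set us) (core I)" and 2: "vs = filter (\<lambda>t. t \<in> set vs) (core I)"
        using mem F(1) unfolding frontier_ok_def by blast+
      show "us = vs" by (rule trans[OF 1 trans[OF eq 2[symmetric]]])
    qed
    have sub: "set ` set ?F \<subseteq> {U. upset_in (set (core I)) (prec I) U}"
      using F(1) unfolding frontier_ok_def by blast
    have card: "card (set (core I)) \<le> sz I"
      using card_length[of "core I"] length_le_sz[of "core I"] core by linarith
    have "length ?F = card (set ?F)" using distinct_card[OF F(2)] by (rule sym)
    also have "\<dots> \<le> (card (set (core I)) + 1) ^ w"
      using card_inj_on_le[OF inj sub ups(1)] ups(2) by (rule order_trans)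
    also have "\<dots> \<le> (sz I + 1) ^ w" using card by (intro power_mono) auto
    finally show ?thesis .
  qed
  then have "1 + length ?F * (sz I + 1) \<le> 1 + (sz I + 1) ^ w * (sz I + 1)"
    by (intro add_left_mono mult_le_mono1)
  ultimately show ?thesis by (rule order_trans)
qed

lemma ptime_verify:
  "ptime {I. valid_inst I \<and> gen_po_width (set (tasks I)) (prec I) \<le> w} verify"
proof -
  let ?D = "{I. valid_inst I \<and> gen_po_width (set (tasks I)) (prec I) \<le> w}"
  have core: "ptime ?D core" unfolding core_def unordered_def by (intro ptime_intros)
  have "ptime ?D (\<lambda>I. fold (extend I) (plan I) [core I])"
  proof (rule ptime_fold)
    show "pbd (\<lambda>n. 1 + (n + 1) ^ w * (n + 1))" by (intro pbd_intros)
    \<comment> \<open>A single round is polynomial-time on every input; the restriction to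
      \<open>?D\<close> serves to bound the iterates.\<close>
    show "ptime UNIV (\<lambda>z. extend (fst z) (fst (snd z)) (snd (snd z)))"
      unfolding extend_def next_tasks_def by (intro ptime_intros)
    show "ptime ?D (\<lambda>I. [core I])" by (intro ptime_intros core)
    show "ptime ?D plan" by (intro ptime_intros)
    show "sz (fold (extend I) us [core I]) \<le> 1 + (sz I + 1) ^ w * (sz I + 1)" if "I \<in> ?D" for I us
      using that sz_frontier by blast
  qed
  then have search: "ptime ?D search" unfolding search_def by (intro ptime_intros)
  have props: "ptime UNIV props" unfolding props_def by (intro ptime_intros)
  obtain k where k: "\<And>I. sz (props I) \<le> (sz I + 2) ^ k"
    using ptime_size[OF props] by (metis UNIV_I)
  have bool: "sz (b :: bool) \<le> 2" for b by (cases b) (auto simp: sz_def cd_simps)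
  have "ptime ?D (\<lambda>I. fold (progress I) (plan I) (True, init I))"
  proof (rule ptime_fold)
    \<comment> \<open>Of the 5, the pair takes 3 and the truth value at most 2.\<close>
    show "pbd (\<lambda>n. n + (n + 2) ^ k + 5)" by (intro pbd_intros)
    show "ptime UNIV (\<lambda>z. progress (fst z) (fst (snd z)) (snd (snd z)))"
      unfolding progress_def by (intro ptime_intros ptime_comp_UNIV[OF props])
    fix I us
    have "sz (snd (fold (progress I) us (True, init I))) \<le> sz I + (sz I + 2) ^ k"
    \<comment> \<open>Only the last step matters: whatever came before, its state is a sublist of
      \<open>props I\<close>. For the empty prefix the state is \<open>init I\<close>.\<close>
    proof (cases us rule: rev_cases)
      case Nil
      then show ?thesis using sz_components(2)[of I] by simp
    next
      case (snoc us' a)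
      then have "sz (snd (fold (progress I) us (True, init I))) \<le> sz (props I)"
        by (simp add: progress_def sz_filter)
      then show ?thesis using k[of I] by linarith
    qed
    then show "sz (fold (progress I) us (True, init I)) \<le> sz I + (sz I + 2) ^ k + 5"
      using bool[of "fst (fold (progress I) us (True, init I))"]
      by (cases "fold (progress I) us (True, init I)") simp
  qed (intro ptime_intros)+
  then show ?thesis
    unfolding verify_def by (intro ptime_intros ptime_mset_eq search)
qed

theorem theorem5:
  fixes w :: nat
  shows "\<exists>M c k. tm_wf M \<and>
    (\<forall>I. valid_inst I \<and> gen_po_width (set (tasks I)) (prec I) \<le> w \<longrightarrow>
       (let n = length (enc_inst I); q = tm_state_after M (enc_inst I) (c * n ^ k + c)
        in (q = 1 \<or> q = 2) \<and> (q = 1 \<longleftrightarrow> plan_verification I)))"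
proof -
  let ?D = "{I. valid_inst I \<and> gen_po_width (set (tasks I)) (prec I) \<le> w}"
  obtain M c k where "tm_wf M"
    "\<forall>I\<in>?D. tm_state_after M (enc_inst I) (c * length (enc_inst I) ^ k + c) = (if verify I then 1 else 2)"
    using ptime_imp_tm[OF ptime_verify[of w]] by blast
  then show ?thesis
    by (intro exI[of _ M] exI[of _ c] exI[of _ k]) (auto simp: Let_def verify_iff)
qed

end
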